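(* Let $n$ be a positive integer, and put $$r_1:=\left\lfloor\frac{3n-1-\sqrt{12n+13}}{3}\right\rfloor+1,\qquad r_2:=\left\lceil\frac{3n-1+\sqrt{12n+13}}{3}\right\rceil-1.$$ Then for every integer $m$ with $0\le m\le n$, $$a(m)=\sum_{\substack{k=r_1\\ k\equiv n\ (\mathrm{mod}\ 2)}}^{r_2}(-1)^{\frac{n-k}{2}}\sum_{r=0}^{m-1+\frac{3n^2+n}{2}}\mathfrak m(k;r)\,\mathfrak m_{odd}\!\left(\frac{3n-k}{2};\,m+\frac{3n^2+n}{2}-r\right).$$
   Context: Here $(a;q)_\infty:=\prod_{j=0}^\infty(1-aq^j)$. The integers $a(m)$ are defined by $$\sum_{m\ge0}a(m)q^m:=\frac{1}{\Theta_6(q)},\qquad \Theta_6(q):=(q;q)_\infty^3(q;q^2)_\infty^2 .$$ For integers $k\ge0$, $\mathfrak m(k;r)$ and $\mathfrak m_{odd}(k;r)$ denote the coefficients of $q^r$ in $A_k(q)$ and $C_k(q)$ respectively, where $$A_k(q):=\sum_{0<t_1<\cdots<t_k}\frac{q^{t_1+\cdots+t_k}}{(1-q^{t_1})^2\cdots(1-q^{t_k})^2},\qquad C_k(q):=\sum_{0<t_1<\cdots<t_k}\frac{q^{2t_1+\cdots+2t_k-k}}{(1-q^{2t_1-1})^2\cdots(1-q^{2t_k-1})^2},$$ and $A_0(q)=C_0(q)=1$. Equivalently, for $k\ge1$, $\mathfrak m(k;r)=\sum m_1m_2\cdots m_k$ over all $0<t_1<\cdots<t_k$ and positive integers $m_1,\dots,m_k$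 with $m_1t_1+\cdots+m_kt_k=r$, and $\mathfrak m_{odd}(k;r)=\sum m_1\cdots m_k$ over those with $m_1(2t_1-1)+\cdots+m_k(2t_k-1)=r$. *)

theory Defs
  imports
    "HOL-Analysis.Infinite_Products"
    "HOL-Analysis.Infinite_Sum"
    "HOL-Computational_Algebra.Formal_Power_Series"
    "HOL-Number_Theory.Cong"
begin

text \<open>
  All generating functions are formal power series in \<open>q = fps_X\<close>.  Infinite products and
  infinite sums are the library's \<open>prodinf\<close> and \<open>infsum\<close> for the \<open>q\<close>-adic topology on
  formal power series.  The coefficients live in the field \<open>rat\<close> so that quotients of series are
  the library's \<open>(/)\<close>; every denominator below has constant coefficient 1, so all coefficients
  are integers.
\<close>

abbreviation q :: "rat fps" where
  "q \<equiv> fps_X"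

definition qpoch_inf :: "rat fps \<Rightarrow> rat fps \<Rightarrow> rat fps" where
  "qpoch_inf a p = (\<Prod>j. 1 - a * p ^ j)"

definition Theta6 :: "rat fps" where
  "Theta6 = qpoch_inf q q ^ 3 * qpoch_inf q (q ^ 2) ^ 2"

definition a_coeff :: "nat \<Rightarrow> rat" where
  "a_coeff m = fps_nth (1 / Theta6) m"

text \<open>
  A chain \<open>0 < t\<^sub>1 < \<dots> < t\<^sub>k\<close> is encoded by the set of its members.
\<close>

definition chains :: "nat \<Rightarrow> nat set set" where
  "chains k = {T. finite T \<and> card T = k \<and> (\<forall>t\<in>T. 0 < t)}"

definition A_gf :: "nat \<Rightarrow> rat fps" where
  "A_gf k = (\<Sum>\<^sub>\<infinity>T\<in>chains k. q ^ (\<Sum>t\<in>T. t) / (\<Prod>t\<in>T. (1 - q ^ t) ^ 2))"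

definition C_gf :: "nat \<Rightarrow> rat fps" where
  "C_gf k = (\<Sum>\<^sub>\<infinity>T\<in>chains k.
            q ^ ((\<Sum>t\<in>T. 2 * t) - k) / (\<Prod>t\<in>T. (1 - q ^ (2 * t - 1)) ^ 2))"

definition mm :: "nat \<Rightarrow> nat \<Rightarrow> rat" where
  "mm k r = fps_nth (A_gf k) r"

definition mm_odd :: "nat \<Rightarrow> nat \<Rightarrow> rat" where
  "mm_odd k r = fps_nth (C_gf k) r"

definition r1 :: "nat \<Rightarrow> int" where
  "r1 n = \<lfloor>(3 * real n - 1 - sqrt (12 * real n + 13)) / 3\<rfloor> + 1"

definition r2 :: "nat \<Rightarrow> int" where
  "r2 n = \<lceil>(3 * real n - 1 + sqrt (12 * real n + 13)) / 3\<rceil> - 1"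

text \<open>
  For \<open>r1 n \<le> k \<le> r2 n\<close> both \<open>k\<close> and \<open>(3 n - k) / 2\<close> are nonnegative, so that they may
  be passed through \<open>nat\<close> without truncation; the exponent \<open>(n - k) / 2\<close> may be negative.
\<close>

lemma r1_nonneg:
  assumes "n > 0"
  shows "0 \<le> r1 n"
proof -
  have "sqrt (12 * real n + 13) \<le> 3 * real n + 2"
  proof (rule real_le_lsqrt)
    have "1 \<le> real n ^ 2"
      using assms by simp
    then show "12 * real n + 13 \<le> (3 * real n + 2) ^ 2"
      by (simp add: power2_eq_square algebra_simps)
  qed simp
  then have "- 1 \<le> (3 * real n - 1 - sqrt (12 * real n + 13)) / 3"
    by simp
  then show ?thesis
    unfolding r1_def by linarith
qed

lemma r2_le: "r2 n \<le> 3 * int n"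
proof -
  have "sqrt (12 * real n + 13) \<le> 6 * real n + 4"
    by (rule real_le_lsqrt) (simp_all add: power2_eq_square algebra_simps)
  then have "(3 * real n - 1 + sqrt (12 * real n + 13)) / 3 \<le> 3 * real n + 1"
    by simp
  then show ?thesis
    unfolding r2_def by linarith
qed

end

theory Submission
  imports Defs "HOL-Computational_Algebra.Polynomial"
begin

text \<open>
  With \<open>x = 2 - \<zeta> - 1/\<zeta>\<close> one has \<open>(1 - p)\<^sup>2 + x p = (1 - \<zeta> p) (1 - p/\<zeta>)\<close>; the same with \<open>\<zeta>\<^sup>2\<close> turns
  \<open>y = 2 - \<zeta>\<^sup>2 - 1/\<zeta>\<^sup>2\<close> into the factors with odd exponents.  Hence the quintuple product is, up to a
  factor free of \<open>\<zeta>\<close>, \<open>(1 - 1/\<zeta>) (\<Sum>k. A\<^sub>k x\<^sup>k) (\<Sum>j. C\<^sub>j y\<^sup>j)\<close>.  In its coefficient at \<open>\<zeta>\<close> to the power \<open>3 n\<close> (after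
  removal of the factor \<open>1 - 1/\<zeta>\<close>) only pairs with \<open>k + 2 j \<ge> 3 n\<close> can occur, and those with
  \<open>k + 2 j > 3 n\<close> start at order \<open>(3 n\<^sup>2 + n)/2 + n + 1\<close> in \<open>q\<close>, because \<open>A\<^sub>k\<close> and \<open>C\<^sub>j\<close> have orders
  \<open>k (k + 1)/2\<close> and \<open>j\<^sup>2\<close>.  The remaining pairs contribute with their leading coefficients
  \<open>(-1)\<close> to the power \<open>k + j\<close>.  The other side of the quintuple product is the product of two Jacobi
  triple products, and its coefficient is evaluated by Euler's pentagonal number theorem in \<open>q\<^sup>2\<close>.

  To avoid convergence in \<open>\<zeta>\<close>, all products are truncated at a large \<open>M\<close>, multiplied by a power of
  \<open>\<zeta>\<close> so as to become polynomials in \<open>\<zeta>\<close>, and compared modulo a power of \<open>q\<close>; the triple product is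
  used in its finite form with Gaussian binomial coefficients.
\<close>

subsection \<open>Congruences modulo powers of the indeterminate\<close>

definition fps_cong :: "nat \<Rightarrow> 'a::comm_ring_1 fps \<Rightarrow> 'a fps \<Rightarrow> bool" where
  "fps_cong L f g \<longleftrightarrow> fps_X ^ L dvd f - g"

lemma fps_X_power_dvd_iff:
  fixes f :: "'a::comm_ring_1 fps"
  shows "fps_X ^ L dvd f \<longleftrightarrow> (\<forall>i<L. fps_nth f i = 0)"
proof
  assume "fps_X ^ L dvd f"
  then obtain g where "f = fps_X ^ L * g" ..
  then show "\<forall>i<L. fps_nth f i = 0"
    by (simp add: fps_X_power_mult_nth)
next
  assume "\<forall>i<L. fps_nth f i = 0"
  then have "f = fps_X ^ L * fps_shift L f"
    by (intro fps_ext) (auto simp: fps_X_power_mult_nth)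
  then show "fps_X ^ L dvd f" ..
qed

lemma fps_cong_iff_nth: "fps_cong L f g \<longleftrightarrow> (\<forall>i<L. fps_nth f i = fps_nth g i)"
  by (simp add: fps_cong_def fps_X_power_dvd_iff)

lemma fps_cong_refl [simp]: "fps_cong L f f"
  by (simp add: fps_cong_def)

lemma fps_cong_sym: "fps_cong L f g \<Longrightarrow> fps_cong L g f"
  by (simp add: fps_cong_iff_nth)

lemma fps_cong_trans [trans]: "fps_cong L f g \<Longrightarrow> fps_cong L g h \<Longrightarrow> fps_cong L f h"
  by (simp add: fps_cong_iff_nth)

lemma fps_cong_mult: "fps_cong L f g \<Longrightarrow> fps_cong L h k \<Longrightarrow> fps_cong L (f * h) (g * k)"
  by (auto simp: fps_cong_iff_nth fps_mult_nth intro!: sum.cong)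

lemma fps_cong_power: "fps_cong L f g \<Longrightarrow> fps_cong L (f ^ n) (g ^ n)"
  by (induction n) (auto intro: fps_cong_mult)

lemma fps_cong_sum: "(\<And>x. x \<in> A \<Longrightarrow> fps_cong L (f x) (g x)) \<Longrightarrow> fps_cong L (sum f A) (sum g A)"
  by (auto simp: fps_cong_iff_nth fps_sum_nth intro!: sum.cong)

lemma fps_cong_cancel_unit:
  fixes f g u :: "'a::field fps"
  assumes "fps_cong L (u * f) (u * g)" "fps_nth u 0 \<noteq> 0"
  shows "fps_cong L f g"
proof -
  have "fps_X ^ L dvd u * (f - g)"
    using assms(1) by (simp add: fps_cong_def right_diff_distrib)
  then show ?thesis
    using assms(2) by (simp add: fps_cong_def dvd_mult_unit_iff')
qed

text \<open>Multiplication by a power of the indeterminate raises the modulus. Next to a factor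
  \<open>q ^ pent n\<close>, a congruence modulo \<open>q ^ (n + 1)\<close> is therefore
  enough.\<close>

lemma fps_cong_X_power_mult:
  assumes "fps_cong L f g"
  shows "fps_cong (K + L) (fps_X ^ K * f) (fps_X ^ K * g)"
  using assms by (auto simp: fps_cong_iff_nth fps_X_power_mult_nth)

lemma fps_cong_X_power_0: "L \<le> k \<Longrightarrow> fps_cong L (fps_X ^ k * f) 0"
  by (simp add: fps_cong_def dvd_mult2 le_imp_power_dvd)

subsection \<open>Gaussian binomial coefficients\<close>

definition qpoch :: "'a::comm_ring_1 \<Rightarrow> nat \<Rightarrow> 'a" where
  "qpoch p n = (\<Prod>i=1..n. 1 - p ^ i)"

text \<open>Gaussian binomial coefficient, with \<open>qpoch p n\<close> as (p;p)_n. The inverses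
  are genuine when \<open>p\<close> has constant coefficient 0. The value 0 for k > n is the
  boundary value that \<open>homogeneous_step\<close> asks for at the top index.\<close>

definition qbin :: "'a::field fps \<Rightarrow> nat \<Rightarrow> nat \<Rightarrow> 'a fps" where
  "qbin p n k =
     (if k \<le> n then qpoch p n * inverse (qpoch p k) * inverse (qpoch p (n - k)) else 0)"

lemma qpoch_0 [simp]: "qpoch p 0 = 1"
  by (simp add: qpoch_def)

lemma qpoch_Suc: "qpoch p (Suc n) = qpoch p n * (1 - p ^ Suc n)"
  by (simp add: qpoch_def)

lemma qpoch_nth_0 [simp]: "fps_nth p 0 = 0 \<Longrightarrow> fps_nth (qpoch p n) 0 = 1"
  for p :: "'a::field fps"
  by (induction n) (simp_all add: qpoch_Suc)

lemma qbin_mult: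
  fixes p :: "'a::field fps"
  assumes "fps_nth p 0 = 0" "k \<le> n"
  shows "qbin p n k * (qpoch p k * qpoch p (n - k)) = qpoch p n"
proof -
  have "inverse (qpoch p k) * qpoch p k = 1" "inverse (qpoch p (n - k)) * qpoch p (n - k) = 1"
    using assms by (simp_all add: inverse_mult_eq_1)
  then show ?thesis
    using assms(2) unfolding qbin_def by (simp add: mult_ac)
qed

lemma qbin_eqI:
  fixes p :: "'a::field fps"
  assumes p: "fps_nth p 0 = 0" and k: "k \<le> n"
    and f: "f * (qpoch p k * qpoch p (n - k)) = qpoch p n"
  shows "qbin p n k = f"
proof -
  have "fps_nth (qpoch p k * qpoch p (n - k)) 0 \<noteq> 0"
    using p by simp
  then have "qpoch p k * qpoch p (n - k) \<noteq> 0"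
    by (metis fps_zero_nth)
  then show ?thesis
    using qbin_mult[OF p k] f by (metis mult_right_cancel)
qed

lemma qbin_0 [simp]: "fps_nth p 0 = 0 \<Longrightarrow> qbin p n 0 = 1"
  by (rule qbin_eqI) simp_all

lemma qbin_self [simp]: "fps_nth p 0 = 0 \<Longrightarrow> qbin p n n = 1"
  by (rule qbin_eqI) simp_all

lemma qbin_eq_0 [simp]: "n < k \<Longrightarrow> qbin p n k = 0"
  by (simp add: qbin_def)

text \<open>Puts both terms of Pascal's rule over the common denominator
  \<open>qpoch p (Suc k) * qpoch p (n - k)\<close>.\<close>

lemma qbin_Suc_Suc_mult:
  fixes p :: "'a::field fps"
  assumes p: "fps_nth p 0 = 0" and "k < n"
  shows "qbin p n (Suc k) * (qpoch p (Suc k) * qpoch p (n - k)) = qpoch p n * (1 - p ^ (n - k))"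
    and "qbin p n k * (qpoch p (Suc k) * qpoch p (n - k)) = qpoch p n * (1 - p ^ Suc k)"
proof -
  have "n - k = Suc (n - Suc k)"
    using assms by simp
  then have "qpoch p (n - k) = qpoch p (n - Suc k) * (1 - p ^ (n - k))"
    by (simp only: qpoch_Suc)
  then show "qbin p n (Suc k) * (qpoch p (Suc k) * qpoch p (n - k)) = qpoch p n * (1 - p ^ (n - k))"
    using qbin_mult[OF p, of "Suc k" n] assms(2) by (simp add: mult_ac)
  show "qbin p n k * (qpoch p (Suc k) * qpoch p (n - k)) = qpoch p n * (1 - p ^ Suc k)"
    using qbin_mult[OF p, of k n] assms(2) by (simp add: qpoch_Suc mult_ac)
qed

text \<open>With cleared denominators this is (1 - p^(n-k)) + p^(n-k) (1 - p^(k+1)) = 1 - p^(n+1).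
  The companion \<open>qbin_Suc_Suc'\<close> puts the power of \<open>p\<close> on the other term;
  the triple product uses one form in each of its two inductions.\<close>

lemma qbin_Suc_Suc:
  fixes p :: "'a::field fps"
  assumes p: "fps_nth p 0 = 0" and "k \<le> n"
  shows "qbin p (Suc n) (Suc k) = qbin p n (Suc k) + p ^ (n - k) * qbin p n k"
proof (cases "k = n")
  case False
  with assms have "k < n" by simp
  note m = qbin_Suc_Suc_mult[OF p this]
  have "p ^ (n - k) * p ^ Suc k = p ^ Suc n"
    using assms by (simp flip: power_add power_Suc2)
  moreover have "(qbin p n (Suc k) + p ^ (n - k) * qbin p n k) * (qpoch p (Suc k) * qpoch p (n - k))
      = qpoch p n * (1 - p ^ (n - k) * p ^ Suc k)"
    unfolding distrib_right mult.assoc[of "p ^ (n - k)"] m by (simp add: algebra_simps)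
  ultimately show ?thesis
    using \<open>k < n\<close> p by (intro qbin_eqI[OF p]) (simp_all add: qpoch_Suc del: power_Suc)
qed (use assms in simp)

lemma qbin_Suc_Suc':
  fixes p :: "'a::field fps"
  assumes p: "fps_nth p 0 = 0" and "k \<le> n"
  shows "qbin p (Suc n) (Suc k) = p ^ Suc k * qbin p n (Suc k) + qbin p n k"
proof (cases "k = n")
  case False
  with assms have "k < n" by simp
  note m = qbin_Suc_Suc_mult[OF p this]
  have "p ^ (n - k) * p ^ Suc k = p ^ Suc n"
    using assms by (simp flip: power_add power_Suc2)
  moreover have "(p ^ Suc k * qbin p n (Suc k) + qbin p n k) * (qpoch p (Suc k) * qpoch p (n - k))
      = qpoch p n * (1 - p ^ (n - k) * p ^ Suc k)"
    unfolding distrib_right mult.assoc[of "p ^ Suc k"] m by (simp add: algebra_simps)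
  ultimately show ?thesis
    using \<open>k < n\<close> p by (intro qbin_eqI[OF p]) (simp_all add: qpoch_Suc del: power_Suc)
qed (use assms in simp)

subsection \<open>A finite form of the Jacobi triple product\<close>

text \<open>Triangular numbers at all integers: \<open>a * (a + 1)\<close> is even and nonnegative
  also for negative \<open>a\<close>, so neither \<open>div\<close> nor \<open>nat\<close> loses
  anything.\<close>

definition tri :: "int \<Rightarrow> nat" where
  "tri a = nat (a * (a + 1) div 2)"

lemma two_tri: "2 * int (tri a) = a * (a + 1)"
proof -
  have "a * (a + 1) \<ge> 0"
    by (cases "a \<ge> 0") (auto intro: mult_nonneg_nonneg mult_nonpos_nonpos)
  then show ?thesis
    by (simp add: tri_def)
qed

lemma tri_rec: "int (tri a) = int (tri (a - 1)) + a"
  using two_tri[of a] two_tri[of "a - 1"] by (simp add: algebra_simps)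

lemma smult_sum_right: "smult c (sum f A) = (\<Sum>x\<in>A. smult c (f x))"
  by (induction A rule: infinite_finite_induct) (simp_all add: smult_add_right)

text \<open>One more linear factor raises the degree of a binary form by one and mixes neighbouring
  coefficients. The condition \<open>c (Suc n) = 0\<close> lets the first partial sum run one index
  further.\<close>

lemma homogeneous_step:
  fixes z w :: "'a::comm_ring_1 poly"
  assumes "c' 0 = a * c 0" and "\<And>i. i \<le> n \<Longrightarrow> c' (Suc i) = a * c (Suc i) + b * c i" and "c (Suc n) = 0"
  shows "(smult a w + smult b z) * (\<Sum>i\<le>n. smult (c i) (z ^ i * w ^ (n - i)))
       = (\<Sum>i\<le>Suc n. smult (c' i) (z ^ i * w ^ (Suc n - i)))"
proof -
  have "smult a w * (\<Sum>i\<le>n. smult (c i) (z ^ i * w ^ (n - i)))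
      = (\<Sum>i\<le>n. smult (a * c i) (z ^ i * w ^ (Suc n - i)))"
    by (auto simp: sum_distrib_left smult_sum_right Suc_diff_le mult_ac intro!: sum.cong)
  also have "\<dots> = (\<Sum>i\<le>Suc n. smult (a * c i) (z ^ i * w ^ (Suc n - i)))"
    using assms(3) by simp
  also have "\<dots> = smult (c' 0) (w ^ Suc n) + (\<Sum>i\<le>n. smult (a * c (Suc i)) (z ^ Suc i * w ^ (n - i)))"
    by (subst sum.atMost_Suc_shift) (simp add: assms(1))
  finally have 1: "smult a w * (\<Sum>i\<le>n. smult (c i) (z ^ i * w ^ (n - i))) = \<dots>" .
  have 2: "smult b z * (\<Sum>i\<le>n. smult (c i) (z ^ i * w ^ (n - i)))
      = (\<Sum>i\<le>n. smult (b * c i) (z ^ Suc i * w ^ (n - i)))"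
    by (auto simp: sum_distrib_left smult_sum_right mult_ac intro!: sum.cong)
  show ?thesis
    unfolding distrib_right 1 2
    by (subst sum.atMost_Suc_shift)
      (simp add: assms(2) smult_add_left add.assoc flip: sum.distrib)
qed

lemma power_tri_shift:
  assumes "int (tri a) + int j = int (tri b) + int k"
  shows "p ^ tri a * p ^ j = (p::'a::monoid_mult) ^ tri b * p ^ k"
  using assms by (metis of_nat_add of_nat_eq_iff power_add)

text \<open>The homogeneous form allows the substitution \<open>z/w = Y/q\<close> without leaving the power series.\<close>

lemma finite_jacobi_triple_product:
  fixes p :: "'a::field fps" and z w :: "'a fps poly"
  assumes p: "fps_nth p 0 = 0"
  shows "(\<Prod>t=1..r. w - smult (p ^ t) z) * (\<Prod>t<s. z - smult (p ^ t) w)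
       = (\<Sum>i\<le>r + s. smult ((- 1) ^ (s + i) * p ^ tri (int i - int s) * qbin p (r + s) i)
                       (z ^ i * w ^ (r + s - i)))"
proof (induction r)
  \<comment> \<open>For r = 0 only the product over t < s remains. Its new factor carries the power
    of \<open>p\<close> at \<open>w\<close>, which fits the Pascal rule
    \<open>qbin_Suc_Suc'\<close>; the induction on r uses \<open>qbin_Suc_Suc\<close>.\<close>
  case 0
  show ?case
  proof (induction s)
    case 0
    show ?case using p by (simp add: tri_def)
  next
    case (Suc s)
    let ?c = "\<lambda>s i. (- 1) ^ (s + i) * p ^ tri (int i - int s) * qbin p s i"
    have "(\<Prod>t<Suc s. z - smult (p ^ t) w)
        = (smult (- (p ^ s)) w + smult 1 z) * (\<Sum>i\<le>s. smult (?c s i) (z ^ i * w ^ (s - i)))"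
      using Suc by (simp add: mult.commute)
    also have "\<dots> = (\<Sum>i\<le>Suc s. smult (?c (Suc s) i) (z ^ i * w ^ (Suc s - i)))"
    proof (rule homogeneous_step)
      have "p ^ tri (0 - int (Suc s)) * p ^ 0 = p ^ tri (0 - int s) * p ^ s"
        using tri_rec[of "- int s"] by (intro power_tri_shift) (simp add: diff_diff_eq minus_diff_commute)
      then show "?c (Suc s) 0 = - (p ^ s) * ?c s 0"
        using p by (simp add: mult_ac)
    next
      fix i assume i: "i \<le> s"
      have e: "p ^ tri (int (Suc i) - int (Suc s)) * p ^ Suc i = p ^ tri (int (Suc i) - int s) * p ^ s"
        using tri_rec[of "int (Suc i) - int s"] by (intro power_tri_shift) (simp add: algebra_simps)
      have e': "tri (int (Suc i) - int (Suc s)) = tri (int i - int s)"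
        by simp
      have "?c (Suc s) (Suc i) = (- 1) ^ (s + i) * ((p ^ tri (int (Suc i) - int (Suc s)) * p ^ Suc i) * qbin p s (Suc i)
               + p ^ tri (int i - int s) * qbin p s i)"
        unfolding qbin_Suc_Suc'[OF p i] e' by (simp add: algebra_simps)
      then show "?c (Suc s) (Suc i) = - (p ^ s) * ?c s (Suc i) + 1 * ?c s i"
        unfolding e by (simp add: algebra_simps)
    qed simp
    finally show ?case by simp
  qed
next
  case (Suc r)
  let ?c = "\<lambda>r i. (- 1) ^ (s + i) * p ^ tri (int i - int s) * qbin p (r + s) i"
  have "(\<Prod>t=1..Suc r. w - smult (p ^ t) z) * (\<Prod>t<s. z - smult (p ^ t) w)
      = (smult 1 w + smult (- (p ^ Suc r)) z) * (\<Sum>i\<le>r + s. smult (?c r i) (z ^ i * w ^ (r + s - i)))"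
    unfolding Suc[symmetric] by (simp add: mult_ac)
  also have "\<dots> = (\<Sum>i\<le>Suc (r + s). smult (?c (Suc r) i) (z ^ i * w ^ (Suc (r + s) - i)))"
  proof (rule homogeneous_step)
    fix i assume i: "i \<le> r + s"
    \<comment> \<open>The power from Pascal's rule turns tri (i + 1 - s) into tri (i - s) and leaves
      exactly the \<open>p ^ Suc r\<close> of the new factor.\<close>
    have e: "p ^ tri (int (Suc i) - int s) * p ^ (r + s - i) = p ^ tri (int i - int s) * p ^ Suc r"
      using i tri_rec[of "int (Suc i) - int s"] by (intro power_tri_shift) (simp add: algebra_simps of_nat_diff)
    have "?c (Suc r) (Suc i) = ?c r (Suc i) - (- 1) ^ (s + i) * (p ^ tri (int (Suc i) - int s) * p ^ (r + s - i)) * qbin p (r + s) i"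
      unfolding add_Suc qbin_Suc_Suc[OF p i] by (simp add: algebra_simps)
    then show "?c (Suc r) (Suc i) = 1 * ?c r (Suc i) + - (p ^ Suc r) * ?c r i"
      unfolding e by (simp add: algebra_simps)
  qed (use p in simp_all)
  finally show ?case by simp
qed

subsection \<open>Elementary symmetric functions\<close>

text \<open>With \<open>u t\<close> of the form q^w / (1 - q^w)^2 and \<open>I = {1..M}\<close>,
  these are the truncations of \<open>A_gf\<close> and \<open>C_gf\<close> to chains with members up
  to \<open>M\<close>.\<close>

definition esym :: "('b \<Rightarrow> 'a::comm_ring_1) \<Rightarrow> 'b set \<Rightarrow> nat \<Rightarrow> 'a" where
  "esym u I k = (\<Sum>T | T \<subseteq> I \<and> card T = k. \<Prod>t\<in>T. u t)"

text \<open>Homogeneous Vieta expansion: choose the set T of factors that contribute their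
  \<open>y\<close> term, then group the choices by \<open>card T\<close>.\<close>

lemma prod_diff_smult_eq_sum_esym:
  assumes "finite I"
  shows "(\<Prod>t\<in>I. z - smult (u t) y)
       = (\<Sum>k\<le>card I. smult ((- 1) ^ k * esym u I k) (y ^ k * z ^ (card I - k)))"
proof -
  let ?h = "\<lambda>T. smult ((- 1) ^ card T * (\<Prod>t\<in>T. u t)) (y ^ card T * z ^ (card I - card T))"
  have "(\<Prod>t\<in>I. z - smult (u t) y) = (\<Prod>t\<in>I. smult (- u t) y + z)"
    by simp
  also have "\<dots> = (\<Sum>T\<in>Pow I. ?h T)"
    unfolding prod_add[OF assms]
  proof (rule sum.cong)
    fix T assume T: "T \<in> Pow I"
    have "(\<Prod>t\<in>T. - u t) = (- 1) ^ card T * (\<Prod>t\<in>T. u t)"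
      using prod.distrib[of "\<lambda>_. - 1" u T] by simp
    then show "(\<Prod>t\<in>T. smult (- u t) y) * (\<Prod>t\<in>I - T. z) = ?h T"
      using T assms unfolding prod_smult by (simp add: card_Diff_subset finite_subset)
  qed simp
  also have "\<dots> = (\<Sum>k\<le>card I. \<Sum>T | T \<in> Pow I \<and> card T = k. ?h T)"
    using assms by (intro sum.group[symmetric]) (auto simp: card_mono)
  also have "\<dots> = (\<Sum>k\<le>card I. smult ((- 1) ^ k * esym u I k) (y ^ k * z ^ (card I - k)))"
    by (auto simp: esym_def sum_distrib_left smult_sum intro!: sum.cong)
  finally show ?thesis .
qed

text \<open>The degree sorts the pairs (k, j): in the coefficient at
  \<open>3 * M + 1 + 3 * n\<close>, pairs with k + 2 j < 3 n are absent and pairs with k + 2 j = 3 n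
  enter with factor 1.\<close>

lemma monic_summand:
  fixes k j M :: nat
  assumes "k \<le> M" "j \<le> M"
  defines "f \<equiv> [:- 1, 1:] * (([:- 1, 1:] ^ 2) ^ k * [:0, 1:] ^ (M - k)) *
                 ((([:0, 1:] ^ 2 - 1) ^ 2) ^ j * ([:0, 1:] ^ 2) ^ (M - j)) :: 'a::idom poly"
  shows "degree f = 3 * M + 1 + k + 2 * j" and "lead_coeff f = 1"
proof -
  have Z2: "[:0, 1:] ^ 2 - 1 = ([:- 1, 0, 1:] :: 'a poly)"
    by (simp add: power2_eq_square one_pCons)
  show "lead_coeff f = 1"
    unfolding f_def Z2 by (simp only: lead_coeff_mult lead_coeff_power) simp
  have nz: "[:- 1, 1:] \<noteq> (0 :: 'a poly)" "[:0, 1:] \<noteq> (0 :: 'a poly)" "[:- 1, 0, 1:] \<noteq> (0 :: 'a poly)"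
    by simp_all
  have "degree f = 1 + (k * (2 * 1) + (M - k) * 1) + (j * (2 * 2) + (M - j) * (2 * 1))"
    unfolding f_def Z2 by (simp only: degree_mult_eq degree_power_eq mult_eq_0_iff power_eq_0_iff nz simp_thms) simp
  then show "degree f = 3 * M + 1 + k + 2 * j"
    using assms by simp
qed

text \<open>The identity (1 - p)^2 + x p = (1 - \<zeta> p) (1 - p/\<zeta>) multiplied by \<zeta>,
  with \<open>a\<close> for p and \<open>Y\<close> for \<zeta>; note x \<zeta> = -(\<zeta> - 1)^2.
  Pulling out \<open>(1 - a) ^ 2\<close> produces the weight a / (1 - a)^2 of the generating
  functions.\<close>

lemma quadratic_factor:
  fixes a :: "'a::field fps" and Y :: "'a fps poly"
  assumes "fps_nth a 0 = 0"
  shows "smult ((1 - a) ^ 2) (Y - smult (a / (1 - a) ^ 2) ((Y - 1) ^ 2)) = (1 - smult a Y) * (Y - smult a 1)"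
proof -
  have "(1 - a) ^ 2 * (a / (1 - a) ^ 2) = a"
    using assms by (simp add: fps_divide_unit mult_ac inverse_mult_eq_1')
  then have "smult ((1 - a) ^ 2) (Y - smult (a / (1 - a) ^ 2) ((Y - 1) ^ 2))
      = smult ((1 - a) ^ 2) Y - smult a ((Y - 1) ^ 2)"
    by (simp add: smult_diff_right)
  also have "\<dots> = [:(1 - a) ^ 2:] * Y - [:a:] * (Y - 1) ^ 2"
    by simp
  also have "[:(1 - a) ^ 2:] = (1 - [:a:]) ^ 2"
    by (simp add: one_pCons power2_eq_square)
  also have "(1 - c) ^ 2 * Y - c * (Y - 1) ^ 2 = (1 - c * Y) * (Y - c * 1)" for c :: "'a fps poly"
    by (simp add: algebra_simps power2_eq_square)
  finally show ?thesis by simp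
qed

lemma prod_quadratic_factors:
  fixes a :: "nat \<Rightarrow> 'a::field fps"
  assumes "\<And>t. t \<in> {1..M} \<Longrightarrow> fps_nth (a t) 0 = 0"
  shows "(\<Prod>t=1..M. (1 - smult (a t) Y) * (Y - smult (a t) 1))
    = smult ((\<Prod>t=1..M. 1 - a t) ^ 2)
       (\<Sum>k\<le>M. smult ((- 1) ^ k * esym (\<lambda>t. a t / (1 - a t) ^ 2) {1..M} k) (((Y - 1) ^ 2) ^ k * Y ^ (M - k)))"
proof -
  have "(\<Prod>t=1..M. (1 - smult (a t) Y) * (Y - smult (a t) 1))
    = (\<Prod>t=1..M. smult ((1 - a t) ^ 2) (Y - smult (a t / (1 - a t) ^ 2) ((Y - 1) ^ 2)))"
    using assms by (intro prod.cong) (simp_all only: quadratic_factor)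
  also have "\<dots> = smult ((\<Prod>t=1..M. 1 - a t) ^ 2) (\<Prod>t=1..M. Y - smult (a t / (1 - a t) ^ 2) ((Y - 1) ^ 2))"
    by (simp only: prod_smult prod_power_distrib)
  finally show ?thesis
    by (simp add: prod_diff_smult_eq_sum_esym)
qed

subsection \<open>Special cases of the triple product\<close>

text \<open>The finite triple product with r = M and s = M + 1; the additional factor at t = 0 is
  \<open>Z - 1\<close>.\<close>

lemma jacobi_triple_product_shifted:
  fixes Z :: "rat fps poly"
  shows "(Z - 1) * (\<Prod>t=1..M. (1 - smult (q ^ t) Z) * (Z - smult (q ^ t) 1))
       = (\<Sum>i\<le>2 * M + 1. smult ((- 1) ^ (M + 1 + i) * q ^ tri (int i - int M - 1) * qbin q (2 * M + 1) i) (Z ^ i))"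
proof -
  have "(\<Prod>t<Suc M. Z - smult (q ^ t) 1) = (Z - 1) * (\<Prod>t=1..M. Z - smult (q ^ t) 1)"
    by (simp only: prod.lessThan_Suc_shift prod.atLeast1_atMost_eq One_nat_def power_0 smult_1_left)
  note * = this
  have eqs: "M + Suc M = 2 * M + 1" "int i - int (Suc M) = int i - int M - 1" "Suc M + i = M + 1 + i" for i
    by simp_all
  show ?thesis
    using finite_jacobi_triple_product[of q, where w = 1 and z = Z and r = M and s = "Suc M", unfolded * eqs]
    by (simp add: prod.distrib mult_ac)
qed

text \<open>Base \<open>q ^ 2\<close> with z = Y and w = q: the factors are q - q^(2t) Y = q (1 -
  q^(2t-1) Y) and Y - q^(2t+1). The surplus \<open>q ^ M\<close> is cancelled at the end.\<close>

lemma jacobi_triple_product_odd: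
  fixes Y :: "rat fps poly"
  shows "(\<Prod>t=1..M. (1 - smult (q ^ (2 * t - 1)) Y) * (Y - smult (q ^ (2 * t - 1)) 1))
       = (\<Sum>l\<le>2 * M. smult ((- 1) ^ (M + l) * q ^ nat ((int l - int M) ^ 2) * qbin (q ^ 2) (2 * M) l) (Y ^ l))"
    (is "?P = ?S")
proof -
  let ?R = "\<lambda>l. (- 1) ^ (M + l) * (q ^ 2) ^ tri (int l - int M) * qbin (q ^ 2) (M + M) l"
  have 1: "[:q:] - smult ((q ^ 2) ^ t) Y = smult q (1 - smult (q ^ (2 * t - 1)) Y)" if "t \<in> {1..M}" for t
  proof -
    have "(q ^ 2) ^ t = q * q ^ (2 * t - 1)"
      using that by (simp flip: power_mult power_Suc)
    then show ?thesis
      by (simp add: smult_diff_right one_pCons)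
  qed
  have 2: "(\<Prod>t<M. Y - smult ((q ^ 2) ^ t) [:q:]) = (\<Prod>t=1..M. Y - smult (q ^ (2 * t - 1)) 1)"
    by (simp add: prod.atLeast1_atMost_eq one_pCons mult.commute flip: power_mult)
  have 3: "smult (?R l) (Y ^ l * [:q:] ^ (M + M - l))
      = smult (q ^ M) (smult ((- 1) ^ (M + l) * q ^ nat ((int l - int M) ^ 2) * qbin (q ^ 2) (2 * M) l) (Y ^ l))"
    if "l \<in> {..M + M}" for l
  proof -
    define b where "b = int l - int M"
    have "int (M + M - l) = int M - b"
      using that by (simp add: b_def of_nat_diff)
    \<comment> \<open>The linear term of 2 tri b = b^2 + b is absorbed by the exponent M - b of w,
      which leaves a pure square.\<close>
    then have "int (2 * tri b + (M + M - l)) = int (M + nat (b ^ 2))"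
      using two_tri[of b] by (simp add: algebra_simps power2_eq_square)
    then have "2 * tri b + (M + M - l) = M + nat (b ^ 2)"
      by linarith
    then have e: "(q ^ 2) ^ tri b * q ^ (M + M - l) = q ^ M * q ^ nat (b ^ 2)"
      by (simp flip: power_mult power_add)
    have "?R l * q ^ (M + M - l)
        = (- 1) ^ (M + l) * qbin (q ^ 2) (2 * M) l * ((q ^ 2) ^ tri b * q ^ (M + M - l))"
      unfolding b_def mult_2 by (simp only: mult_ac)
    also have "\<dots> = q ^ M * ((- 1) ^ (M + l) * q ^ nat (b ^ 2) * qbin (q ^ 2) (2 * M) l)"
      unfolding e by (simp only: mult_ac)
    finally have f: "?R l * q ^ (M + M - l) = \<dots>" .
    have "smult (?R l) (Y ^ l * [:q:] ^ (M + M - l)) = smult (?R l * q ^ (M + M - l)) (Y ^ l)"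
      by (simp add: poly_const_pow)
    then show ?thesis
      unfolding f by (simp only: b_def smult_smult)
  qed
  have "smult (q ^ M) ?P = (\<Prod>t=1..M. [:q:] - smult ((q ^ 2) ^ t) Y) * (\<Prod>t<M. Y - smult ((q ^ 2) ^ t) [:q:])"
    unfolding 2 using 1 by (simp add: prod.distrib prod_smult)
  also have "\<dots> = (\<Sum>l\<le>M + M. smult (?R l) (Y ^ l * [:q:] ^ (M + M - l)))"
    by (rule finite_jacobi_triple_product) simp
  also have "\<dots> = smult (q ^ M) ?S"
    unfolding smult_sum_right mult_2 using 3 by (intro sum.cong) (simp_all add: mult_2)
  finally show ?thesis
    using smult_cancel[of "q ^ M" ?P ?S] by simp
qed

text \<open>Base \<open>q ^ 6\<close> with z = 1 and w = q^4, where q^4 - q^(6t) = q^4 (1 -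
  q^(6t-4)). The exponent becomes 6 tri b - 4 b = 3 b^2 - b, twice a pentagonal number.\<close>

lemma finite_pentagonal:
  "(\<Prod>t<M. (1 - q ^ (6 * t + 2)) * (1 - q ^ (6 * t + 4)))
   = (\<Sum>i\<le>2 * M. (- 1) ^ (M + i) * q ^ nat (3 * (int i - int M) ^ 2 - (int i - int M)) * qbin (q ^ 6) (2 * M) i)"
    (is "?P = ?S")
proof -
  let ?R = "\<lambda>i. (- 1) ^ (M + i) * (q ^ 6) ^ tri (int i - int M) * qbin (q ^ 6) (M + M) i"
  have 1: "(\<Prod>t=1..M. q ^ 4 - (q ^ 6) ^ t) = (\<Prod>t<M. q ^ 4 * (1 - q ^ (6 * t + 2)))"
  proof -
    have "q ^ (6 * Suc t) = q ^ 4 * q ^ (6 * t + 2)" for t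
      unfolding power_add[symmetric] by (rule arg_cong[where f = "(^) q"]) simp
    then show ?thesis
      by (simp only: prod.atLeast1_atMost_eq One_nat_def right_diff_distrib mult_1_right flip: power_mult)
  qed
  have 2: "?R i * (q ^ 4) ^ (M + M - i)
      = q ^ (4 * M) * ((- 1) ^ (M + i) * q ^ nat (3 * (int i - int M) ^ 2 - (int i - int M)) * qbin (q ^ 6) (2 * M) i)"
    if "i \<in> {..M + M}" for i
  proof -
    define b where "b = int i - int M"
    have "b \<le> b ^ 2"
      by (cases "b > 0") (auto simp: power2_eq_square intro: order_trans[of _ 0])
    then have "int (6 * tri b + 4 * (M + M - i)) = int (4 * M + nat (3 * b ^ 2 - b))"
      using that two_tri[of b] by (simp add: b_def algebra_simps power2_eq_square of_nat_diff)
    then have "6 * tri b + 4 * (M + M - i) = 4 * M + nat (3 * b ^ 2 - b)"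
      by linarith
    then have e: "(q ^ 6) ^ tri b * (q ^ 4) ^ (M + M - i) = q ^ (4 * M) * q ^ nat (3 * b ^ 2 - b)"
      by (simp flip: power_mult power_add)
    have "?R i * (q ^ 4) ^ (M + M - i)
        = (- 1) ^ (M + i) * qbin (q ^ 6) (2 * M) i * ((q ^ 6) ^ tri b * (q ^ 4) ^ (M + M - i))"
      unfolding b_def mult_2 by (simp only: mult_ac)
    then show ?thesis
      unfolding e by (simp only: b_def mult_ac)
  qed
  have "q ^ (4 * M) * ?P = (\<Prod>t=1..M. q ^ 4 - (q ^ 6) ^ t) * (\<Prod>t<M. 1 - (q ^ 6) ^ t * q ^ 4)"
  proof -
    have "q ^ (6 * t + 4) = (q ^ 6) ^ t * q ^ 4" for t
      by (simp only: power_add power_mult)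
    then show ?thesis
      unfolding 1 by (simp only: prod.distrib prod_constant card_lessThan power_mult mult.assoc)
  qed
  \<comment> \<open>Here z and w are constant polynomials, so evaluation at 0 brings the polynomial
    identity down to power series.\<close>
  also have "\<dots> = poly ((\<Prod>t=1..M. [:q ^ 4:] - smult ((q ^ 6) ^ t) 1) * (\<Prod>t<M. 1 - smult ((q ^ 6) ^ t) [:q ^ 4:])) 0"
    by (simp add: poly_prod)
  also have "\<dots> = (\<Sum>i\<le>M + M. ?R i * (q ^ 4) ^ (M + M - i))"
    by (subst finite_jacobi_triple_product) (simp_all add: poly_sum)
  also have "\<dots> = q ^ (4 * M) * ?S"
    unfolding sum_distrib_left mult_2 using 2 by (intro sum.cong) (simp_all add: mult_2)
  finally show ?thesis by simp
qed

text \<open>The even exponents up to 6 M are split into the residues 2, 4 and 0 modulo 6.\<close>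

lemma qpoch_triple:
  "(\<Prod>t<M. (1 - q ^ (6 * t + 2)) * (1 - q ^ (6 * t + 4))) * qpoch (q ^ 6) M = qpoch (q ^ 2) (3 * M)"
proof (induction M)
  case (Suc M)
  have eqs: "3 * Suc M = Suc (Suc (Suc (3 * M)))" "2 * Suc (3 * M) = 6 * M + 2"
    "2 * Suc (Suc (3 * M)) = 6 * M + 4" "2 * Suc (Suc (Suc (3 * M))) = 6 * Suc M"
    by simp_all
  show ?case
    unfolding eqs(1) prod.lessThan_Suc qpoch_Suc power_mult[symmetric] eqs Suc[symmetric]
    by (simp only: mult_ac)
qed simp

subsection \<open>The quintuple product\<close>

text \<open>Meant for sums whose terms in \<open>B\<close> match the target sum modulo q^L, while
  all other terms are already of order at least L.\<close>

lemma fps_cong_sum_reindex: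
  assumes "finite A" "B \<subseteq> A" "bij_betw h B C"
    and "\<And>x. x \<in> B \<Longrightarrow> fps_cong L (f x) (g (h x))"
    and "\<And>x. x \<in> A - B \<Longrightarrow> fps_cong L (f x) 0"
  shows "fps_cong L (sum f A) (sum g C)"
proof -
  have "fps_cong L (sum f A) (\<Sum>x\<in>A. if x \<in> B then g (h x) else 0)"
    using assms by (intro fps_cong_sum) auto
  also have "(\<Sum>x\<in>A. if x \<in> B then g (h x) else 0) = (\<Sum>x\<in>B. g (h x))"
    using assms by (simp add: sum.If_cases Int_absorb1)
  also have "\<dots> = sum g C"
    using assms(3) by (rule sum.reindex_bij_betw)
  finally show ?thesis .
qed

lemma qpoch_cong:
  fixes d :: nat
  assumes "d > 0" "L \<le> r" "L \<le> s"
  shows "fps_cong L (qpoch (q ^ d) r) (qpoch (q ^ d) s)"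
proof -
  have *: "fps_cong L (qpoch (q ^ d) r) (qpoch (q ^ d) L)" if "L \<le> r" for r
    using that
  proof (induction r rule: dec_induct)
    case (step r)
    have "L \<le> d * Suc r"
      using step assms(1) by (cases d) auto
    then have "fps_cong L (qpoch (q ^ d) r - q ^ (d * Suc r) * qpoch (q ^ d) r) (qpoch (q ^ d) L)"
      using step.IH fps_cong_X_power_0[of L "d * Suc r"] by (auto simp: fps_cong_iff_nth)
    then show ?case
      by (simp add: qpoch_Suc power_add power_mult algebra_simps)
  qed simp
  show ?thesis
    using *[OF assms(2)] *[OF assms(3)] fps_cong_sym fps_cong_trans by blast
qed

text \<open>Far from both ends a Gaussian binomial is 1/(p;p)_\<infinity> modulo q^L: the indices n,
  i, n - i and M are all at least L, so their \<open>qpoch\<close> values agree. A second factor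
  \<open>qpoch\<close> clears the denominator and is then cancelled as a unit.\<close>

lemma qbin_cong:
  fixes d :: nat
  assumes "d > 0" "L \<le> i" "i + L \<le> n" "L \<le> M"
  shows "fps_cong L (qbin (q ^ d) n i * qpoch (q ^ d) M) 1"
proof -
  let ?u = "qpoch (q ^ d) M"
  have "fps_cong L (qbin (q ^ d) n i * (?u * ?u)) (qbin (q ^ d) n i * (qpoch (q ^ d) i * qpoch (q ^ d) (n - i)))"
    using assms by (intro fps_cong_mult qpoch_cong fps_cong_refl) auto
  also have "\<dots> = qpoch (q ^ d) n"
    using assms by (intro qbin_mult) auto
  also have "fps_cong L \<dots> ?u"
    using assms by (intro qpoch_cong) auto
  finally have "fps_cong L (?u * (qbin (q ^ d) n i * ?u)) (?u * 1)"
    by (simp add: mult_ac)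
  then show ?thesis
    by (rule fps_cong_cancel_unit) (use assms in simp)
qed

section \<open>Euler's pentagonal number theorem in q^2, truncated\<close>

definition pentagonal_sum :: "nat \<Rightarrow> rat fps" where
  "pentagonal_sum n = (\<Sum>c\<in>{- int n..int n}. (- 1) ^ nat \<bar>c\<bar> * q ^ nat (3 * c ^ 2 - c))"

lemma abs_le_pentagonal: "\<bar>c\<bar> \<le> 3 * c ^ 2 - (c::int)"
proof (cases "c = 0")
  case False
  then have "1 * \<bar>c\<bar> \<le> \<bar>c\<bar> * \<bar>c\<bar>"
    by (intro mult_right_mono) auto
  then show ?thesis
    by (simp add: power2_eq_square)
qed simp

lemma bij_betw_centered: "n \<le> M \<Longrightarrow> bij_betw (\<lambda>i. int i - int M) {i. \<bar>int i - int M\<bar> \<le> int n} {- int n..int n}"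
  by (rule bij_betwI[where g = "\<lambda>c. nat (c + int M)"]) auto

lemma pentagonal_cong:
  assumes "2 * n + 1 \<le> M"
  shows "fps_cong (n + 1) (qpoch (q ^ 2) M) (pentagonal_sum n)"
proof -
  let ?t = "\<lambda>i. (- 1) ^ (M + i) * q ^ nat (3 * (int i - int M) ^ 2 - (int i - int M)) * qbin (q ^ 6) (2 * M) i * qpoch (q ^ 6) M"
  have "fps_cong (n + 1) (qpoch (q ^ 2) M) (qpoch (q ^ 2) (3 * M))"
    using assms by (intro qpoch_cong) auto
  also have "qpoch (q ^ 2) (3 * M) = (\<Sum>i\<le>2 * M. ?t i)"
    unfolding qpoch_triple[symmetric] finite_pentagonal sum_distrib_right ..
  also have "fps_cong (n + 1) (\<Sum>i\<le>2 * M. ?t i) (pentagonal_sum n)"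
    unfolding pentagonal_sum_def
  proof (rule fps_cong_sum_reindex[OF _ _ bij_betw_centered])
    fix i assume i: "i \<in> {i. \<bar>int i - int M\<bar> \<le> int n}"
    have "even (M + i) \<longleftrightarrow> even (nat \<bar>int i - int M\<bar>)"
      by (auto simp: even_nat_iff)
    then have "?t i = (- 1) ^ nat \<bar>int i - int M\<bar> * q ^ nat (3 * (int i - int M) ^ 2 - (int i - int M)) *
        (qbin (q ^ 6) (2 * M) i * qpoch (q ^ 6) M)"
      by (simp add: minus_one_power_iff)
    \<comment> \<open>From |i - M| \<le> n and 2 n + 1 \<le> M, both i and 2 M - i are at least n +
      1.\<close>
    moreover have "fps_cong (n + 1) (qbin (q ^ 6) (2 * M) i * qpoch (q ^ 6) M) 1"
      using i assms by (intro qbin_cong) auto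
    ultimately show "fps_cong (n + 1) (?t i) ((- 1) ^ nat \<bar>int i - int M\<bar> * q ^ nat (3 * (int i - int M) ^ 2 - (int i - int M)))"
      by (metis fps_cong_mult fps_cong_refl mult.right_neutral)
  next
    fix i assume i: "i \<in> {..2 * M} - {i. \<bar>int i - int M\<bar> \<le> int n}"
    have "n + 1 \<le> nat (3 * (int i - int M) ^ 2 - (int i - int M))"
      using i abs_le_pentagonal[of "int i - int M"] by auto
    from fps_cong_X_power_0[OF this, of "(- 1) ^ (M + i) * qbin (q ^ 6) (2 * M) i * qpoch (q ^ 6) M"]
    show "fps_cong (n + 1) (?t i) 0"
      by (simp only: mult_ac)
  qed (use assms in auto)
  finally show ?thesis .
qed

section \<open>Evaluation of a coefficient of the quintuple product\<close>

abbreviation pent :: "nat \<Rightarrow> nat" where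
  "pent n \<equiv> (3 * n ^ 2 + n) div 2"

lemma two_pent: "2 * pent n = 3 * n ^ 2 + n"
  by (rule dvd_mult_div_cancel) simp

lemma int_pent: "2 * int (pent n) = 3 * int n ^ 2 + int n"
  using arg_cong[OF two_pent, of int n]
  by (simp only: of_nat_mult of_nat_add of_nat_power of_nat_numeral)

text \<open>The coefficient collects the pairs with i + 2 l = 3 M + 1 + 3 n. Put l = M + n + c and i
  = M + 1 + n - 2 c. The mixed terms cancel in tri (n - 2 c) + (n + c)^2 = pent n + 3 c^2 - c, so
  the sum over c is \<open>q ^ pent n\<close> times a pentagonal series. The two
  \<open>qpoch\<close> factors in front turn the Gaussian binomials into 1.\<close>

lemma quintuple_product_coeff:
  fixes n M :: nat
  assumes M: "pent n + n + 1 + 3 * n \<le> M"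
  defines "Z \<equiv> [:0, 1:] :: rat fps poly"
  shows "fps_cong (pent n + (n + 1))
    (qpoch q M * qpoch (q ^ 2) M *
     coeff ((Z - 1) * (\<Prod>t=1..M. (1 - smult (q ^ t) Z) * (Z - smult (q ^ t) 1)) *
       (\<Prod>t=1..M. (1 - smult (q ^ (2 * t - 1)) (Z ^ 2)) * (Z ^ 2 - smult (q ^ (2 * t - 1)) 1)))
       (3 * M + 1 + 3 * n))
    (q ^ pent n * qpoch (q ^ 2) M)"
    (is "fps_cong _ (_ * _ * coeff (?P * ?Q) ?K) _")
proof -
  define L where "L = pent n + (n + 1)"
  define a where "a = (\<lambda>i. (- 1) ^ (M + 1 + i) * q ^ tri (int i - int M - 1) * qbin q (2 * M + 1) i)"
  define b where "b = (\<lambda>l. (- 1) ^ (M + l) * q ^ nat ((int l - int M) ^ 2) * qbin (q ^ 2) (2 * M) l)"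
  define A where "A = {(i, l). i \<le> 2 * M + 1 \<and> l \<le> 2 * M \<and> i + 2 * l = ?K}"
  define h where "h = (\<lambda>(i::nat, l). int l - int M - int n)"
  define B where "B = {x \<in> A. \<bar>h x\<bar> \<le> int n}"
  have Zpow: "Z ^ i = monom 1 i" for i
    unfolding Z_def by (simp add: monom_altdef)
  have P: "?P = (\<Sum>i\<le>2 * M + 1. monom (a i) i)"
    unfolding jacobi_triple_product_shifted Zpow a_def by (simp add: smult_monom)
  have Q: "?Q = (\<Sum>l\<le>2 * M. monom (b l) (2 * l))"
    unfolding jacobi_triple_product_odd power_mult[symmetric] unfolding Zpow b_def by (simp add: smult_monom)
  have "coeff (?P * ?Q) ?K = (\<Sum>(i, l)\<in>{..2 * M + 1} \<times> {..2 * M}. if i + 2 * l = ?K then a i * b l else 0)"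
    unfolding P Q sum_product sum.cartesian_product
    by (simp add: coeff_sum mult_monom case_prod_unfold)
  also have "\<dots> = (\<Sum>(i, l)\<in>A. a i * b l)"
    unfolding A_def by (intro sum.mono_neutral_cong_right) (auto split: if_splits)
  finally have "qpoch q M * qpoch (q ^ 2) M * coeff (?P * ?Q) ?K
      = (\<Sum>(i, l)\<in>A. qpoch q M * qpoch (q ^ 2) M * (a i * b l))"
    by (simp add: sum_distrib_left case_prod_unfold)
  also have "fps_cong L \<dots> (\<Sum>c\<in>{- int n..int n}. q ^ pent n * ((- 1) ^ nat \<bar>c\<bar> * q ^ nat (3 * c ^ 2 - c)))"
  proof (rule fps_cong_sum_reindex)
    show "finite A"
      by (rule finite_subset[of _ "{..2 * M + 1} \<times> {..2 * M}"]) (auto simp: A_def)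
    show "B \<subseteq> A"
      by (auto simp: B_def)
    show "bij_betw h B {- int n..int n}"
      by (rule bij_betwI[where g = "\<lambda>c. (nat (int M + 1 + int n - 2 * c), nat (c + int M + int n))"])
        (use M in \<open>auto simp: B_def A_def h_def\<close>)
    have exponent: "tri (int i - int M - 1) + nat ((int l - int M) ^ 2) = pent n + nat (3 * c ^ 2 - c)"
      if "(i, l) \<in> A" "c = h (i, l)" for i l c
    proof -
      have l: "int l = int M + int n + c" and i: "int i = int M + 1 + int n - 2 * c"
        using that by (auto simp: A_def h_def)
      have e: "int i - int M - 1 = int n - 2 * c" "int l - int M = int n + c"
        using i l by simp_all
      have "2 * int (tri (int n - 2 * c)) + 2 * (int n + c) ^ 2 = 2 * int (pent n) + 2 * (3 * c ^ 2 - c)"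
        unfolding two_tri int_pent by (simp add: algebra_simps power2_eq_square)
      moreover have "3 * c ^ 2 - c \<ge> 0"
        using abs_le_pentagonal[of c] by linarith
      ultimately have "int (tri (int n - 2 * c) + nat ((int n + c) ^ 2)) = int (pent n + nat (3 * c ^ 2 - c))"
        by simp
      then show ?thesis
        unfolding e by linarith
    qed
    have term_eq: "qpoch q M * qpoch (q ^ 2) M * (a i * b l)
        = q ^ pent n * ((- 1) ^ nat \<bar>c\<bar> * q ^ nat (3 * c ^ 2 - c)) *
          ((qbin q (2 * M + 1) i * qpoch q M) * (qbin (q ^ 2) (2 * M) l * qpoch (q ^ 2) M))"
      if "(i, l) \<in> A" "c = h (i, l)" for i l c
    proof -
      have "int (M + 1 + i + (M + l)) = c + 2 * (2 * int M + 1 + int n - c)"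
        using that by (auto simp: A_def h_def)
      then have parity: "even (M + 1 + i + (M + l)) \<longleftrightarrow> even (nat \<bar>c\<bar>)"
        by (metis dvd_triv_left even_add even_nat_iff even_of_nat abs_ge_zero even_abs_add_iff add_0)
      then have s: "(- 1) ^ (M + 1 + i) * (- 1) ^ (M + l) = (- 1 :: rat fps) ^ nat \<bar>c\<bar>"
        unfolding power_add[symmetric] unfolding minus_one_power_iff parity by simp
      have "qpoch q M * qpoch (q ^ 2) M * (a i * b l)
        = ((- 1) ^ (M + 1 + i) * (- 1) ^ (M + l)) * (q ^ tri (int i - int M - 1) * q ^ nat ((int l - int M) ^ 2)) *
          ((qbin q (2 * M + 1) i * qpoch q M) * (qbin (q ^ 2) (2 * M) l * qpoch (q ^ 2) M))"
        unfolding a_def b_def by (simp only: mult_ac)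
      also have "q ^ tri (int i - int M - 1) * q ^ nat ((int l - int M) ^ 2) = q ^ pent n * q ^ nat (3 * c ^ 2 - c)"
        unfolding power_add[symmetric] exponent[OF that] ..
      finally show ?thesis
        unfolding s by (simp only: mult_ac)
    qed
    show "fps_cong L (case x of (i, l) \<Rightarrow> qpoch q M * qpoch (q ^ 2) M * (a i * b l))
        (q ^ pent n * ((- 1) ^ nat \<bar>h x\<bar> * q ^ nat (3 * h x ^ 2 - h x)))" if "x \<in> B" for x
    proof -
      obtain i l where x: "x = (i, l)" by fastforce
      have A: "(i, l) \<in> A" and c: "\<bar>int l - int M - int n\<bar> \<le> int n"
        using that by (auto simp: x B_def h_def)
      \<comment> \<open>Since |c| \<le> n, the index i is at most M + 1 + 3 n; the summand
        \<open>3 * n\<close> in the bound on \<open>M\<close> ensures i + L \<le> 2 M + 1.\<close>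
      have "fps_cong L (qbin q (2 * M + 1) i * qpoch q M) 1"
        using qbin_cong[of 1 L i "2 * M + 1" M] A c M by (auto simp: A_def L_def)
      moreover have "fps_cong L (qbin (q ^ 2) (2 * M) l * qpoch (q ^ 2) M) 1"
        using A c M by (intro qbin_cong) (auto simp: A_def L_def)
      ultimately have "fps_cong L (qpoch q M * qpoch (q ^ 2) M * (a i * b l))
          (q ^ pent n * ((- 1) ^ nat \<bar>h x\<bar> * q ^ nat (3 * h x ^ 2 - h x)) * (1 * 1))"
        unfolding x term_eq[OF A refl] by (intro fps_cong_mult fps_cong_refl)
      then show ?thesis
        by (simp add: x)
    qed
    show "fps_cong L (case x of (i, l) \<Rightarrow> qpoch q M * qpoch (q ^ 2) M * (a i * b l)) 0" if "x \<in> A - B" for x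
    proof -
      obtain i l where x: "x = (i, l)" by fastforce
      define c where "c = h x"
      have A: "(i, l) \<in> A" and "\<bar>c\<bar> > int n"
        using that by (auto simp: x B_def c_def)
      then have "L \<le> pent n + nat (3 * c ^ 2 - c)"
        using abs_le_pentagonal[of c] unfolding L_def by linarith
      from fps_cong_X_power_0[OF this]
      have "fps_cong L (q ^ (pent n + nat (3 * c ^ 2 - c)) * ((- 1) ^ nat \<bar>c\<bar> *
          ((qbin q (2 * M + 1) i * qpoch q M) * (qbin (q ^ 2) (2 * M) l * qpoch (q ^ 2) M)))) 0" .
      then show ?thesis
        unfolding x prod.case term_eq[OF A c_def[unfolded x]] power_add by (simp only: mult_ac)
    qed
  qed
  also have "(\<Sum>c\<in>{- int n..int n}. q ^ pent n * ((- 1) ^ nat \<bar>c\<bar> * q ^ nat (3 * c ^ 2 - c)))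
      = q ^ pent n * pentagonal_sum n"
    by (simp add: pentagonal_sum_def sum_distrib_left)
  also have "fps_cong L \<dots> (q ^ pent n * qpoch (q ^ 2) M)"
    unfolding L_def using M by (intro fps_cong_X_power_mult fps_cong_sym[OF pentagonal_cong]) auto
  finally show ?thesis
    unfolding L_def .
qed

subsection \<open>Truncation of the generating functions\<close>

lemma fps_cong_0_iff: "fps_cong L f 0 \<longleftrightarrow> fps_X ^ L dvd f"
  by (simp add: fps_cong_def)

text \<open>The factor with index j is 1 modulo q^j, so the coefficient of q^r is final after r + 1
  factors. The limit is assembled from these final coefficients.\<close>

lemma qpoch_inf_cong:
  assumes a: "fps_nth a 0 = 0" and p: "fps_nth p 0 = 0" and "L \<le> M"
  shows "fps_cong L (qpoch_inf a p) (\<Prod>j<M. 1 - a * p ^ j)"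
proof -
  define f where "f = (\<lambda>j. 1 - a * p ^ j)"
  define S where "S = Abs_fps (\<lambda>r. fps_nth (prod f {..<Suc r}) r)"
  have stable: "fps_cong L (prod f {..<M}) (prod f {..<L})" if "L \<le> M" for L M
    using that
  proof (induction M rule: dec_induct)
    case (step M)
    have "q dvd a" "q dvd p"
      using a p fps_X_power_dvd_iff[of 1 a] fps_X_power_dvd_iff[of 1 p] by simp_all
    then have "q ^ M dvd a * p ^ M"
      by (simp add: dvd_mult dvd_power_same)
    then have "q ^ L dvd prod f {..<M} * (a * p ^ M)"
      using step.hyps by (meson dvd_mult dvd_trans le_imp_power_dvd)
    then have "fps_cong L (prod f {..<M} - prod f {..<M} * (a * p ^ M)) (prod f {..<L})"
      using step.IH by (simp add: fps_cong_iff_nth fps_X_power_dvd_iff)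
    then show ?case
      by (simp add: f_def right_diff_distrib)
  qed simp
  have S: "fps_nth S r = fps_nth (prod f {..<M}) r" if "r < M" for r M
    using stable[of "Suc r" M] that by (simp add: S_def fps_cong_iff_nth)
  have "(\<lambda>n. \<Prod>i\<le>n. f (i + 0)) \<longlonglongrightarrow> S"
  proof (rule tendsto_fpsI)
    fix r
    show "\<forall>\<^sub>F n in sequentially. fps_nth (\<Prod>i\<le>n. f (i + 0)) r = fps_nth S r"
      using eventually_ge_at_top[of r]
    proof eventually_elim
      case (elim n)
      then show ?case
        using S[of r "Suc n"] by (simp add: lessThan_Suc_atMost)
    qed
  qed
  \<comment> \<open>\<open>raw_has_prod\<close> demands a nonzero limit; the constant coefficient 1
    provides it.\<close>
  moreover have "fps_nth S 0 = 1"
    using a by (simp add: S_def f_def)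
  then have "S \<noteq> 0"
    by auto
  ultimately have "f has_prod S"
    by (simp add: has_prod_def raw_has_prod_def)
  then have "qpoch_inf a p = S"
    unfolding qpoch_inf_def f_def by (rule has_prod_unique[symmetric])
  then show ?thesis
    using assms(3) by (auto simp: fps_cong_iff_nth S[of _ M] f_def)
qed

lemma Theta6_cong:
  assumes "L \<le> M"
  shows "fps_cong L Theta6 (qpoch q M ^ 3 * (\<Prod>t=1..M. 1 - q ^ (2 * t - 1)) ^ 2)"
proof -
  have "(\<Prod>j<M. 1 - q * q ^ j) = qpoch q M"
    by (simp add: qpoch_def prod.atLeast1_atMost_eq)
  moreover have "(\<Prod>j<M. 1 - q * (q ^ 2) ^ j) = (\<Prod>t=1..M. 1 - q ^ (2 * t - 1))"
    by (simp add: prod.atLeast1_atMost_eq power_mult)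
  ultimately show ?thesis
    using qpoch_inf_cong[OF _ _ assms, of q q] qpoch_inf_cong[OF _ _ assms, of q "q ^ 2"]
    unfolding Theta6_def by (intro fps_cong_mult fps_cong_power) simp_all
qed

lemma Theta6_nth_0: "fps_nth Theta6 0 = 1"
  using Theta6_cong[of 1 1] by (simp add: fps_cong_iff_nth qpoch_def fps_nth_power_0)

lemma fps_prod_divide:
  fixes a b :: "'b \<Rightarrow> 'a::field fps"
  assumes "\<And>t. t \<in> T \<Longrightarrow> fps_nth (b t) 0 \<noteq> 0"
  shows "prod a T / prod b T = (\<Prod>t\<in>T. a t / b t)"
proof -
  have "prod a T * inverse (prod b T) = (\<Prod>t\<in>T. a t * inverse (b t))"
    by (induction T rule: infinite_finite_induct) (simp_all add: fps_inverse_mult mult_ac)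
  moreover have "fps_nth (prod b T) 0 \<noteq> 0"
    using assms by (induction T rule: infinite_finite_induct) auto
  ultimately show ?thesis
    using assms by (simp add: fps_divide_unit)
qed

lemma one_minus_X_power_square_nth_0: "w > 0 \<Longrightarrow> fps_nth ((1 - q ^ w) ^ 2) 0 \<noteq> 0"
  by (cases w) (simp_all add: fps_nth_power_0)

lemma finite_Pow_card: "finite {T. T \<subseteq> {1..M::nat} \<and> card T = k}"
  by (rule finite_subset[of _ "Pow {1..M}"]) auto

text \<open>A chain with a member t > r does not affect the coefficient of q^r, so this coefficient
  is already that of the finite sum over chains inside {1..r}.\<close>

lemma infsum_chains_cong:
  fixes f :: "nat set \<Rightarrow> rat fps"
  assumes f: "\<And>T t. T \<in> chains k \<Longrightarrow> t \<in> T \<Longrightarrow> q ^ t dvd f T" and "L \<le> Suc M"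
  shows "fps_cong L (infsum f (chains k)) (\<Sum>T | T \<subseteq> {1..M} \<and> card T = k. f T)"
proof -
  define I where "I = (\<lambda>M. {T. T \<subseteq> {1..M::nat} \<and> card T = k})"
  define S where "S = Abs_fps (\<lambda>r. fps_nth (sum f (I r)) r)"
  have I: "I M \<subseteq> chains k" "finite (I M)" for M
    using finite_Pow_card by (auto simp: I_def chains_def intro: finite_subset)
  have S: "fps_nth (sum f F) r = fps_nth S r" if F: "finite F" "I r \<subseteq> F" "F \<subseteq> chains k" for F r
  proof -
    have "fps_nth (f T) r = 0" if T: "T \<in> F - I r" for T
    proof -
      have "T \<in> chains k"
        using T F by auto
      then obtain t where "t \<in> T" "t > r"
        using T by (auto simp: I_def chains_def subset_iff Suc_le_eq not_le)
      then show ?thesis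
        using f[OF \<open>T \<in> chains k\<close>] by (simp add: fps_X_power_dvd_iff)
    qed
    then have "sum (\<lambda>T. fps_nth (f T) r) (I r) = sum (\<lambda>T. fps_nth (f T) r) F"
      using F by (intro sum.mono_neutral_left) auto
    then show ?thesis
      by (simp add: S_def fps_sum_nth)
  qed
  have "(f has_sum S) (chains k)"
    unfolding has_sum_def
  proof (rule tendsto_fpsI)
    fix r
    show "\<forall>\<^sub>F F in finite_subsets_at_top (chains k). fps_nth (sum f F) r = fps_nth S r"
      unfolding eventually_finite_subsets_at_top using I[of r] S by (intro exI[of _ "I r"]) simp
  qed
  then have "infsum f (chains k) = S"
    by (rule infsumI)
  moreover have "fps_nth S r = fps_nth (sum f (I M)) r" if "r < L" for r
  proof -
    have "I r \<subseteq> I M"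
      using that \<open>L \<le> Suc M\<close> by (auto simp: I_def)
    then show ?thesis
      using S I by auto
  qed
  ultimately show ?thesis
    by (simp add: fps_cong_iff_nth I_def)
qed

lemma dvd_fps_divide:
  fixes a b d :: "'a::field fps"
  assumes "d dvd a" "fps_nth b 0 \<noteq> 0"
  shows "d dvd a / b"
  using assms by (simp add: fps_divide_unit)

text \<open>Serves \<open>A_gf\<close> with w t = t and \<open>C_gf\<close> with w t = 2 t - 1;
  \<open>t \<le> w t\<close> yields the divisibility by \<open>q ^ t\<close>.\<close>

lemma esym_chains_cong:
  fixes w :: "nat \<Rightarrow> nat"
  assumes w: "\<And>t. t > 0 \<Longrightarrow> t \<le> w t" and "L \<le> Suc M"
    and f: "\<And>T. T \<in> chains k \<Longrightarrow> f T = (\<Prod>t\<in>T. q ^ w t / (1 - q ^ w t) ^ 2)"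
  shows "fps_cong L (infsum f (chains k)) (esym (\<lambda>t. q ^ w t / (1 - q ^ w t) ^ 2) {1..M} k)"
proof -
  have "q ^ t dvd f T" if "T \<in> chains k" "t \<in> T" for T t
  proof -
    have t: "t > 0" "finite T"
      using that by (auto simp: chains_def)
    then have "q ^ t dvd q ^ w t / (1 - q ^ w t) ^ 2"
      using w[OF t(1)]
      by (intro dvd_fps_divide le_imp_power_dvd one_minus_X_power_square_nth_0) simp_all
    also have "\<dots> dvd f T"
      unfolding f[OF that(1)] using that t by (intro dvd_prodI)
    finally show ?thesis .
  qed
  then have "fps_cong L (infsum f (chains k)) (\<Sum>T | T \<subseteq> {1..M} \<and> card T = k. f T)"
    using assms(2) by (rule infsum_chains_cong)
  also have "(\<Sum>T | T \<subseteq> {1..M} \<and> card T = k. f T) = esym (\<lambda>t. q ^ w t / (1 - q ^ w t) ^ 2) {1..M} k"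
    unfolding esym_def by (intro sum.cong refl f) (auto simp: chains_def intro: finite_subset)
  finally show ?thesis .
qed

lemma A_gf_cong:
  assumes "L \<le> Suc M"
  shows "fps_cong L (A_gf k) (esym (\<lambda>t. q ^ t / (1 - q ^ t) ^ 2) {1..M} k)"
  unfolding A_gf_def
proof (rule esym_chains_cong[of "\<lambda>t. t"])
  fix T assume T: "T \<in> chains k"
  then have "fps_nth ((1 - q ^ t) ^ 2) 0 \<noteq> 0" if "t \<in> T" for t
    using that by (intro one_minus_X_power_square_nth_0) (auto simp: chains_def)
  then show "q ^ (\<Sum>t\<in>T. t) / (\<Prod>t\<in>T. (1 - q ^ t) ^ 2) = (\<Prod>t\<in>T. q ^ t / (1 - q ^ t) ^ 2)"
    unfolding power_sum by (rule fps_prod_divide)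
qed (use assms in auto)

text \<open>Chain members are positive, so no subtraction is truncated and the exponent in
  \<open>C_gf\<close> is the sum of the odd parts.\<close>

lemma chains_sum_odd:
  assumes "T \<in> chains k"
  shows "(\<Sum>t\<in>T. 2 * t) = (\<Sum>t\<in>T. 2 * t - 1) + k"
proof -
  have "(\<Sum>t\<in>T. 2 * t) = (\<Sum>t\<in>T. (2 * t - 1) + 1)"
    using assms by (intro sum.cong) (auto simp: chains_def)
  then show ?thesis
    using assms unfolding sum.distrib by (simp add: chains_def)
qed

lemma C_gf_cong:
  assumes "L \<le> Suc M"
  shows "fps_cong L (C_gf k) (esym (\<lambda>t. q ^ (2 * t - 1) / (1 - q ^ (2 * t - 1)) ^ 2) {1..M} k)"
  unfolding C_gf_def
proof (rule esym_chains_cong[of "\<lambda>t. 2 * t - 1"])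
  fix T assume T: "T \<in> chains k"
  then have "fps_nth ((1 - q ^ (2 * t - 1)) ^ 2) 0 \<noteq> 0" if "t \<in> T" for t
    using that by (intro one_minus_X_power_square_nth_0) (auto simp: chains_def)
  then show "q ^ ((\<Sum>t\<in>T. 2 * t) - k) / (\<Prod>t\<in>T. (1 - q ^ (2 * t - 1)) ^ 2)
      = (\<Prod>t\<in>T. q ^ (2 * t - 1) / (1 - q ^ (2 * t - 1)) ^ 2)"
    unfolding chains_sum_odd[OF T] add_diff_cancel_right' power_sum by (rule fps_prod_divide)
qed (use assms in auto)

section \<open>Orders of the generating functions in q\<close>

lemma sum_distinct_pos_ge:
  assumes "finite T" "\<forall>t\<in>T. 0 < t"
  shows "card T * (card T + 1) \<le> 2 * \<Sum>T"
  using assms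
proof (induction rule: finite_linorder_max_induct)
  case (insert b A)
  \<comment> \<open>The maximum b is split off; the other members are positive and below it, so b
    \<ge> card A + 1.\<close>
  have "A \<subseteq> {1..<b}"
    using insert by (auto simp: Suc_le_eq)
  then have "card A \<le> card {1..<b}"
    by (intro card_mono) auto
  moreover have "b > 0"
    using insert by auto
  ultimately show ?case
    using insert by auto
qed simp

lemma X_power_dvd_esym:
  assumes w: "\<And>t. t > 0 \<Longrightarrow> w t > 0"
    and L: "\<And>T. T \<in> chains k \<Longrightarrow> L \<le> (\<Sum>t\<in>T. w t)"
  shows "q ^ L dvd esym (\<lambda>t. q ^ w t / (1 - q ^ w t) ^ 2) {1..M} k"
  unfolding esym_def
proof (rule dvd_sum)
  fix T assume "T \<in> {T. T \<subseteq> {1..M} \<and> card T = k}"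
  then have T: "T \<in> chains k"
    by (auto simp: chains_def intro: finite_subset)
  then have nz: "fps_nth ((1 - q ^ w t) ^ 2) 0 \<noteq> 0" if "t \<in> T" for t
    using that w[of t] by (intro one_minus_X_power_square_nth_0) (auto simp: chains_def)
  have "q ^ L dvd (\<Prod>t\<in>T. q ^ w t)"
    using L[OF T] by (simp add: le_imp_power_dvd flip: power_sum)
  also have "\<dots> dvd (\<Prod>t\<in>T. q ^ w t / (1 - q ^ w t) ^ 2)"
    by (rule prod_dvd_prod) (use nz in \<open>auto intro: dvd_fps_divide\<close>)
  finally show "q ^ L dvd (\<Prod>t\<in>T. q ^ w t / (1 - q ^ w t) ^ 2)" .
qed

lemma X_power_dvd_esym_A: "q ^ (k * (k + 1) div 2) dvd esym (\<lambda>t. q ^ t / (1 - q ^ t) ^ 2) {1..M} k"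
proof (rule X_power_dvd_esym)
  fix T assume "T \<in> chains k"
  then show "k * (k + 1) div 2 \<le> (\<Sum>t\<in>T. t)"
    using sum_distinct_pos_ge[of T] by (auto simp: chains_def)
qed

lemma X_power_dvd_esym_C:
  "q ^ (k ^ 2) dvd esym (\<lambda>t. q ^ (2 * t - 1) / (1 - q ^ (2 * t - 1)) ^ 2) {1..M} k"
proof (rule X_power_dvd_esym)
  fix T assume T: "T \<in> chains k"
  have "k * (k + 1) \<le> 2 * \<Sum>T"
    using sum_distinct_pos_ge[of T] T by (auto simp: chains_def)
  then show "k ^ 2 \<le> (\<Sum>t\<in>T. 2 * t - 1)"
    using chains_sum_odd[OF T] by (simp add: power2_eq_square flip: sum_distrib_left)
qed simp

lemma X_power_dvd_A_gf: "q ^ (k * (k + 1) div 2) dvd A_gf k"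
  using A_gf_cong[of "k * (k + 1) div 2" "k * (k + 1) div 2" k] X_power_dvd_esym_A
  unfolding fps_cong_0_iff[symmetric] by (rule fps_cong_trans) simp

lemma X_power_dvd_C_gf: "q ^ (k ^ 2) dvd C_gf k"
  using C_gf_cong[of "k ^ 2" "k ^ 2" k] X_power_dvd_esym_C
  unfolding fps_cong_0_iff[symmetric] by (rule fps_cong_trans) simp

lemma pent_le_quadratic:
  assumes "2 * int (pent n) + 2 * (int n + 1) \<le> int k * (int k + 1) + 2 * int j ^ 2"
  shows "pent n + (n + 1) \<le> k * (k + 1) div 2 + j ^ 2"
proof -
  have "int (2 * pent n + 2 * (n + 1)) \<le> int (k * (k + 1) + 2 * j ^ 2)"
    using assms by (simp only: of_nat_mult of_nat_add of_nat_power of_nat_numeral of_nat_1)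
  then have "2 * pent n + 2 * (n + 1) \<le> k * (k + 1) + 2 * j ^ 2"
    by (simp only: of_nat_le_iff)
  also have "k * (k + 1) = 2 * (k * (k + 1) div 2)"
    by simp
  finally have "2 * (pent n + (n + 1)) \<le> 2 * (k * (k + 1) div 2 + j ^ 2)"
    by (simp only: distrib_left)
  then show ?thesis
    by (rule mult_left_le_imp_le) simp
qed

subsection \<open>Comparison of the leading coefficients\<close>

text \<open>With a = k - n, b = j - n and s = k + 2 j - 3 n - 1, the form k (k + 1) + 2 j^2 exceeds
  3 n^2 + 3 n by a (a + 1) + 2 b^2 + 2 n s, and this must be at least 2. For s > 0 the last term
  suffices; for s = 0 either b = 0 and a = 1, or 2 b^2 \<ge> 2. Equality at k = n + 1, j = n fixes
  the modulus.\<close>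

lemma quadratic_form_gt:
  assumes "n > 0" "3 * n < k + 2 * j"
  shows "pent n + (n + 1) \<le> k * (k + 1) div 2 + j ^ 2"
proof -
  define a b s where "a = int k - int n" and "b = int j - int n" and "s = a + 2 * b - 1"
  have s: "s \<ge> 0"
    using assms by (simp add: a_def b_def s_def)
  have ge: "2 \<le> a * (a + 1) + 2 * b ^ 2 + 2 * int n * s"
  proof (cases "s = 0")
    case True
    show ?thesis
    proof (cases "b = 0")
      case True
      then show ?thesis using \<open>s = 0\<close> by (simp add: s_def)
    next
      case False
      then have "1 \<le> b ^ 2"
        by (simp add: int_one_le_iff_zero_less)
      moreover have "0 \<le> a * (a + 1)"
        using two_tri[of a] by linarith
      ultimately show ?thesis using True by simp
    qed
  next
    case False
    then have "1 \<le> int n * s"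
      using s assms(1) by (simp add: int_one_le_iff_zero_less)
    moreover have "0 \<le> a * (a + 1)"
      using two_tri[of a] by linarith
    moreover have "0 \<le> b ^ 2" by simp
    ultimately show ?thesis by linarith
  qed
  have "int k = int n + a" "int j = int n + b"
    by (simp_all add: a_def b_def)
  then have eq: "int k * (int k + 1) + 2 * int j ^ 2
      = 3 * int n ^ 2 + int n + 2 * int n + (a * (a + 1) + 2 * b ^ 2 + 2 * int n * s)"
    by (simp add: s_def algebra_simps power2_eq_square)
  have "2 * int (pent n) + 2 * (int n + 1) \<le> int k * (int k + 1) + 2 * int j ^ 2"
    unfolding int_pent eq using ge by simp
  then show ?thesis
    by (rule pent_le_quadratic)
qed

definition top_pairs :: "nat \<Rightarrow> (nat \<times> nat) set" where
  "top_pairs n = {(k, j). k + 2 * j = 3 * n}"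

lemma finite_top_pairs: "finite (top_pairs n)"
  by (rule finite_subset[of _ "{..3 * n} \<times> {..3 * n}"]) (auto simp: top_pairs_def)

text \<open>Second evaluation of the same coefficient, through elementary symmetric functions: pairs
  with k + 2 j < 3 n drop out by degree, pairs with k + 2 j > 3 n by their order in q, and the
  remaining polynomials are monic of the required degree.\<close>

lemma coeff_product_expansion:
  fixes n M :: nat
  assumes n: "n > 0" and M: "pent n + n + 1 + 3 * n \<le> M"
  defines "Z \<equiv> [:0, 1:] :: rat fps poly"
  shows "fps_cong (pent n + (n + 1))
    (coeff ((Z - 1) * (\<Prod>t=1..M. (1 - smult (q ^ t) Z) * (Z - smult (q ^ t) 1)) *
       (\<Prod>t=1..M. (1 - smult (q ^ (2 * t - 1)) (Z ^ 2)) * (Z ^ 2 - smult (q ^ (2 * t - 1)) 1)))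
       (3 * M + 1 + 3 * n))
    (qpoch q M ^ 2 * (\<Prod>t=1..M. 1 - q ^ (2 * t - 1)) ^ 2 *
     (\<Sum>(k, j)\<in>top_pairs n. (- 1) ^ (k + j) * (A_gf k * C_gf j)))"
    (is "fps_cong ?L (coeff (_ * ?P * ?Q) ?K) (?u ^ 2 * ?v ^ 2 * _)")
proof -
  define EA where "EA = esym (\<lambda>t. q ^ t / (1 - q ^ t) ^ 2) {1..M}"
  define EC where "EC = esym (\<lambda>t. q ^ (2 * t - 1) / (1 - q ^ (2 * t - 1)) ^ 2) {1..M}"
  define f where "f = (\<lambda>k j. (Z - 1) * (((Z - 1) ^ 2) ^ k * Z ^ (M - k)) *
                 (((Z ^ 2 - 1) ^ 2) ^ j * (Z ^ 2) ^ (M - j)))"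
  have Z1: "Z - 1 = [:- 1, 1:]"
    by (simp add: Z_def one_pCons)
  have f: "degree (f k j) = 3 * M + 1 + k + 2 * j" "lead_coeff (f k j) = 1" if "k \<le> M" "j \<le> M" for k j
    unfolding f_def Z1 unfolding Z_def using monic_summand[OF that, where 'a = "rat fps"] by simp_all
  have P: "?P = smult (?u ^ 2) (\<Sum>k\<le>M. smult ((- 1) ^ k * EA k) (((Z - 1) ^ 2) ^ k * Z ^ (M - k)))"
    unfolding EA_def qpoch_def by (rule prod_quadratic_factors) simp
  have Q: "?Q = smult (?v ^ 2) (\<Sum>j\<le>M. smult ((- 1) ^ j * EC j) (((Z ^ 2 - 1) ^ 2) ^ j * (Z ^ 2) ^ (M - j)))"
    unfolding EC_def by (rule prod_quadratic_factors) simp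
  have "(Z - 1) * ?P * ?Q = smult (?u ^ 2 * ?v ^ 2)
      (\<Sum>(k, j)\<in>{..M} \<times> {..M}. smult ((- 1) ^ (k + j) * (EA k * EC j)) (f k j))"
  proof -
    have *: "(Z - 1) * smult c F * smult d G = smult (c * d) ((Z - 1) * (F * G))" for c d F G
      by (simp add: mult_ac)
    show ?thesis
      unfolding P Q * unfolding sum_product unfolding sum_distrib_left sum.cartesian_product[symmetric] f_def
      by (intro arg_cong[where f = "smult _"] sum.cong) (simp_all add: power_add mult_ac)
  qed
  then have eq: "coeff ((Z - 1) * ?P * ?Q) ?K = ?u ^ 2 * ?v ^ 2 *
      (\<Sum>(k, j)\<in>{..M} \<times> {..M}. (- 1) ^ (k + j) * (EA k * EC j) * coeff (f k j) ?K)"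
    by (simp add: coeff_sum case_prod_unfold)
  show ?thesis
    unfolding eq
  proof (rule fps_cong_mult[OF fps_cong_refl], rule fps_cong_sum_reindex)
    show "top_pairs n \<subseteq> {..M} \<times> {..M}"
      using M by (auto simp: top_pairs_def)
    show "bij_betw (\<lambda>x. x) (top_pairs n) (top_pairs n)"
      by (simp add: bij_betw_def)
    show "fps_cong ?L (case x of (k, j) \<Rightarrow> (- 1) ^ (k + j) * (EA k * EC j) * coeff (f k j) ?K)
        (case x of (k, j) \<Rightarrow> (- 1) ^ (k + j) * (A_gf k * C_gf j))" if "x \<in> top_pairs n" for x
    proof -
      obtain k j where x: "x = (k, j)" by fastforce
      have kj: "k + 2 * j = 3 * n"
        using that by (simp add: x top_pairs_def)
      then have "k \<le> M" "j \<le> M"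
        using M by linarith+
      then have "coeff (f k j) ?K = 1"
        using f[of k j] kj by (simp add: add.assoc)
      moreover have "fps_cong ?L (EA k) (A_gf k)" "fps_cong ?L (EC j) (C_gf j)"
        unfolding EA_def EC_def using M by (intro fps_cong_sym[OF A_gf_cong] fps_cong_sym[OF C_gf_cong]; simp)+
      ultimately show ?thesis
        unfolding x by (auto intro!: fps_cong_mult)
    qed
    show "fps_cong ?L (case x of (k, j) \<Rightarrow> (- 1) ^ (k + j) * (EA k * EC j) * coeff (f k j) ?K) 0"
      if "x \<in> {..M} \<times> {..M} - top_pairs n" for x
    proof -
      obtain k j where x: "x = (k, j)" by fastforce
      have kj: "k \<le> M" "j \<le> M" "k + 2 * j \<noteq> 3 * n"
        using that by (auto simp: x top_pairs_def)
      show ?thesis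
      proof (cases "k + 2 * j < 3 * n")
        case True
        then have "coeff (f k j) ?K = 0"
          using f(1)[OF kj(1,2)] by (intro coeff_eq_0) simp
        then show ?thesis
          by (simp add: x)
      next
        case False
        then have "?L \<le> k * (k + 1) div 2 + j ^ 2"
          using kj(3) n by (intro quadratic_form_gt) auto
        then have "q ^ ?L dvd q ^ (k * (k + 1) div 2) * q ^ (j ^ 2)"
          unfolding power_add[symmetric] by (rule le_imp_power_dvd)
        also have "\<dots> dvd EA k * EC j"
          unfolding EA_def EC_def by (intro mult_dvd_mono X_power_dvd_esym_A X_power_dvd_esym_C)
        finally show ?thesis
          by (simp add: x fps_cong_0_iff)
      qed
    qed
  qed simp
qed

text \<open>The two evaluations are equated and the unit (q^2;q^2)_M is cancelled. The surviving
  factor (q;q)_M^3 (q;q^2)_M^2 is the truncation of \<open>Theta6\<close>.\<close>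

lemma Theta6_mult_top_sum:
  assumes n: "n > 0"
  shows "fps_cong (pent n + (n + 1))
    (Theta6 * (\<Sum>(k, j)\<in>top_pairs n. (- 1) ^ (k + j) * (A_gf k * C_gf j))) (q ^ pent n)"
    (is "fps_cong ?L (_ * ?S) _")
proof -
  define M where "M = pent n + n + 1 + 3 * n"
  define v where "v = (\<Prod>t=1..M. 1 - q ^ (2 * t - 1))"
  let ?u = "qpoch q M" and ?w = "qpoch (q ^ 2) M"
  have "fps_cong ?L (?u * ?w * (?u ^ 2 * v ^ 2 * ?S)) (q ^ pent n * ?w)"
    unfolding v_def
    by (rule fps_cong_trans[OF fps_cong_mult[OF fps_cong_refl fps_cong_sym[OF coeff_product_expansion]]
            quintuple_product_coeff])
      (use n in \<open>simp_all add: M_def\<close>)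
  then have "fps_cong ?L (?w * (?u ^ 3 * v ^ 2 * ?S)) (?w * q ^ pent n)"
    by (simp add: mult_ac power2_eq_square power3_eq_cube)
  then have "fps_cong ?L (?u ^ 3 * v ^ 2 * ?S) (q ^ pent n)"
    by (rule fps_cong_cancel_unit) simp
  moreover have "fps_cong ?L Theta6 (?u ^ 3 * v ^ 2)"
    unfolding v_def by (rule Theta6_cong) (simp add: M_def)
  ultimately show ?thesis
    by (blast intro: fps_cong_trans fps_cong_mult fps_cong_refl)
qed

text \<open>Division by the unit \<open>Theta6\<close> turns the right side into
  \<open>q ^ pent n\<close> times the series of the \<open>a_coeff\<close>; the index m + pent n
  lies below the modulus because m \<le> n.\<close>

lemma a_coeff_eq_nth:
  assumes "n > 0" "m \<le> n"
  shows "a_coeff m = (\<Sum>(k, j)\<in>top_pairs n. (- 1) ^ (k + j) * fps_nth (A_gf k * C_gf j) (m + pent n))"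
proof -
  let ?S = "\<Sum>(k, j)\<in>top_pairs n. (- 1) ^ (k + j) * (A_gf k * C_gf j)"
  have eq: "Theta6 * (q ^ pent n * (1 / Theta6)) = q ^ pent n"
    using inverse_mult_eq_1'[of Theta6] Theta6_nth_0 by (simp add: fps_divide_unit mult_ac)
  have "fps_cong (pent n + (n + 1)) (Theta6 * ?S) (Theta6 * (q ^ pent n * (1 / Theta6)))"
    unfolding eq by (rule Theta6_mult_top_sum[OF assms(1)])
  then have "fps_cong (pent n + (n + 1)) ?S (q ^ pent n * (1 / Theta6))"
    by (rule fps_cong_cancel_unit) (simp add: Theta6_nth_0)
  then have "fps_nth ?S (m + pent n) = fps_nth (q ^ pent n * (1 / Theta6)) (m + pent n)"
    using assms(2) by (simp add: fps_cong_iff_nth)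
  also have "\<dots> = a_coeff m"
    by (simp add: fps_X_power_mult_nth a_coeff_def)
  finally have "a_coeff m = fps_nth ?S (m + pent n)" ..
  moreover have "fps_nth ((- 1) ^ i * f) r = (- 1) ^ i * fps_nth f r" for i r and f :: "rat fps"
    by (cases "even i") simp_all
  ultimately show ?thesis
    by (simp add: fps_sum_nth case_prod_unfold)
qed

section \<open>Passage to the summation range of the theorem\<close>

lemma r_bounds_iff: "r1 n \<le> k \<and> k \<le> r2 n \<longleftrightarrow> (3 * (k - int n) + 1) ^ 2 < 12 * int n + 13"
proof -
  \<comment> \<open>Floor plus one and ceiling minus one make both bounds strict, so they combine to
    |3 (k - n) + 1| < sqrt (12 n + 13), which can be squared.\<close>
  have "r1 n \<le> k \<longleftrightarrow> (3 * real n - 1 - sqrt (12 * real n + 13)) / 3 < real_of_int k"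
    by (simp only: r1_def add1_zle_eq floor_less_iff)
  moreover have "k \<le> r2 n \<longleftrightarrow> real_of_int k < (3 * real n - 1 + sqrt (12 * real n + 13)) / 3"
    by (simp only: r2_def le_diff_eq add1_zle_eq less_ceiling_iff)
  ultimately have "r1 n \<le> k \<and> k \<le> r2 n \<longleftrightarrow> \<bar>3 * (real_of_int k - real n) + 1\<bar> < sqrt (12 * real n + 13)"
    by (auto simp: abs_less_iff field_simps)
  also have "\<dots> \<longleftrightarrow> (3 * (real_of_int k - real n) + 1) ^ 2 < 12 * real n + 13"
    by (metis real_sqrt_abs real_sqrt_less_iff)
  also have "\<dots> \<longleftrightarrow> real_of_int ((3 * (k - int n) + 1) ^ 2) < real_of_int (12 * int n + 13)"
    by simp
  also have "\<dots> \<longleftrightarrow> (3 * (k - int n) + 1) ^ 2 < 12 * int n + 13"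
    by (rule of_int_less_iff)
  finally show ?thesis .
qed

text \<open>For k = n + 2 b and j = n - b the product has order at least pent n + 3 b^2 + b. Outside
  the range (6 b + 1)^2 \<ge> 12 n + 13, that is 3 b^2 + b \<ge> n + 1 > m.\<close>

lemma nth_A_gf_C_gf_eq_0:
  assumes "(k, j) \<in> top_pairs n" "m \<le> n" "\<not> (r1 n \<le> int k \<and> int k \<le> r2 n)"
  shows "fps_nth (A_gf k * C_gf j) (m + pent n) = 0"
proof -
  have kj: "int k + 2 * int j = 3 * int n"
    using assms(1) by (auto simp: top_pairs_def)
  define d where "d = int k - int n"
  define b where "b = int n - int j"
  have d: "d = 2 * b" and k: "int k = int n + 2 * b" and j: "int j = int n - b"
    using kj by (simp_all add: d_def b_def)
  have "12 * int n + 13 \<le> (3 * d + 1) ^ 2"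
    using assms(3) unfolding r_bounds_iff d_def by simp
  then have "12 * int n + 12 \<le> 12 * (3 * b ^ 2 + b)"
    by (simp add: d power2_eq_square algebra_simps)
  moreover have eq: "int k * (int k + 1) + 2 * int j ^ 2 = 3 * int n ^ 2 + int n + 2 * (3 * b ^ 2 + b)"
    unfolding k j by (simp add: power2_eq_square algebra_simps)
  ultimately have "2 * int (pent n) + 2 * (int n + 1) \<le> int k * (int k + 1) + 2 * int j ^ 2"
    unfolding int_pent eq by simp
  then have "pent n + (n + 1) \<le> k * (k + 1) div 2 + j ^ 2"
    by (rule pent_le_quadratic)
  then have "m + pent n < k * (k + 1) div 2 + j ^ 2"
    using assms(2) by (auto intro: less_le_trans)
  moreover have "q ^ (k * (k + 1) div 2 + j ^ 2) dvd A_gf k * C_gf j"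
    unfolding power_add by (intro mult_dvd_mono X_power_dvd_A_gf X_power_dvd_C_gf)
  ultimately show ?thesis
    by (simp add: fps_X_power_dvd_iff)
qed

text \<open>For j > 0 the series \<open>C_gf j\<close> has no constant term, so the last term r = N
  of the Cauchy product drops out.\<close>

lemma nth_A_gf_C_gf:
  assumes "j > 0" "N > 0"
  shows "fps_nth (A_gf k * C_gf j) N = (\<Sum>r = 0..N - 1. mm k r * mm_odd j (N - r))"
proof -
  have "fps_nth (C_gf j) 0 = 0"
    using X_power_dvd_C_gf[of j] assms(1) unfolding fps_X_power_dvd_iff by simp
  moreover have "{0..N} = insert N {0..N - 1}"
    using assms(2) by auto
  ultimately show ?thesis
    using assms(2) by (simp add: fps_mult_nth mm_def mm_odd_def)
qed

theorem corollary1p2: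
  fixes n m :: nat
  assumes "n > 0" and "m \<le> n"
  shows "a_coeff m =
    (\<Sum>k | r1 n \<le> k \<and> k \<le> r2 n \<and> [k = int n] (mod 2).
       (- 1) powi ((int n - k) div 2) *
       (\<Sum>r = 0..m + (3 * n ^ 2 + n) div 2 - 1.
          mm (nat k) r * mm_odd (nat ((3 * int n - k) div 2)) (m + (3 * n ^ 2 + n) div 2 - r)))"
proof -
  define B where "B = {(k, j) \<in> top_pairs n. r1 n \<le> int k \<and> int k \<le> r2 n}"
  define F where "F = (\<lambda>k. (- 1) powi ((int n - k) div 2) *
       (\<Sum>r = 0..m + pent n - 1.
          mm (nat k) r * mm_odd (nat ((3 * int n - k) div 2)) (m + pent n - r)))"
  have "a_coeff m = (\<Sum>(k, j)\<in>B. (- 1) ^ (k + j) * fps_nth (A_gf k * C_gf j) (m + pent n))"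
    unfolding a_coeff_eq_nth[OF assms] B_def using finite_top_pairs
    by (intro sum.mono_neutral_right) (auto intro!: nth_A_gf_C_gf_eq_0[OF _ assms(2)])
  also have "\<dots> = (\<Sum>(k, j)\<in>B. F (int k))"
  proof (rule sum.cong)
    fix x assume "x \<in> B"
    then obtain k j where x: "x = (k, j)" and kj: "k + 2 * j = 3 * n"
      and bounds: "r1 n \<le> int k" "int k \<le> r2 n"
      by (auto simp: B_def top_pairs_def)
    \<comment> \<open>The value j = 0 would give k = 3 n, and then (6 n + 1)^2 < 12 n + 13 would
      force 36 n^2 < 12.\<close>
    have "j > 0"
    proof (rule ccontr)
      assume "\<not> j > 0"
      then have "(6 * int n + 1) ^ 2 < 12 * int n + 13"
        using bounds r_bounds_iff[of n "int k"] kj by auto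
      moreover have "1 \<le> int n ^ 2"
        using assms(1) by (simp add: int_one_le_iff_zero_less)
      ultimately show False
        by (simp add: power2_eq_square algebra_simps)
    qed
    moreover have "m + pent n > 0"
    proof -
      have "0 < 2 * pent n"
        unfolding two_pent using assms(1) by simp
      then show ?thesis by linarith
    qed
    ultimately have nth: "fps_nth (A_gf k * C_gf j) (m + pent n)
        = (\<Sum>r = 0..m + pent n - 1. mm k r * mm_odd j (m + pent n - r))"
      by (intro nth_A_gf_C_gf) auto
    have "3 * int n - int k = 2 * int j" "int n - int k = 2 * (int j - int n)"
      using kj by simp_all
    then have k: "nat ((3 * int n - int k) div 2) = j" "(int n - int k) div 2 = int j - int n"
      by simp_all
    \<comment> \<open>The exponent (n - k)/2 = j - n may be negative, so only its parity is
      compared; it agrees with that of k + j because k and n have equal parity.\<close>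
    have "even (k + j) \<longleftrightarrow> even (int j - int n)"
      using kj by presburger
    then have sign: "(- 1) powi (int j - int n) = (- 1 :: rat) ^ (k + j)"
      by (simp add: power_int_minus_left minus_one_power_iff)
    show "(case x of (k, j) \<Rightarrow> (- 1) ^ (k + j) * fps_nth (A_gf k * C_gf j) (m + pent n))
        = (case x of (k, j) \<Rightarrow> F (int k))"
      unfolding x prod.case F_def nth k sign nat_int ..
  qed simp
  also have "\<dots> = (\<Sum>k | r1 n \<le> k \<and> k \<le> r2 n \<and> [k = int n] (mod 2). F k)"
  proof (rule sum.reindex_bij_witness[where i = "\<lambda>k. (nat k, nat ((3 * int n - k) div 2))" and j = "\<lambda>(k, j). int k"])
    fix k assume k: "k \<in> {k. r1 n \<le> k \<and> k \<le> r2 n \<and> [k = int n] (mod 2)}"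
    \<comment> \<open>These bounds and the parity of k make both \<open>nat\<close> conversions and
      the division by 2 exact, so that j = (3 n - k)/2 completes the pair.\<close>
    then have "0 \<le> k" "k \<le> 3 * int n"
      using r1_nonneg[OF assms(1)] r2_le[of n] by auto
    moreover have "even (3 * int n - k)"
      using k by (auto simp: cong_iff_dvd_diff)
    then have "k + 2 * ((3 * int n - k) div 2) = 3 * int n"
      by simp
    ultimately have "nat k + 2 * nat ((3 * int n - k) div 2) = 3 * n"
      by linarith
    then show "(nat k, nat ((3 * int n - k) div 2)) \<in> B"
      using k \<open>0 \<le> k\<close> by (simp add: B_def top_pairs_def)
    show "(case (nat k, nat ((3 * int n - k) div 2)) of (k, j) \<Rightarrow> int k) = k"
      using \<open>0 \<le> k\<close> by simp
  next
    fix x assume "x \<in> B"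
    then obtain k j where x: "x = (k, j)" and kj: "k + 2 * j = 3 * n"
      and bounds: "r1 n \<le> int k" "int k \<le> r2 n"
      by (auto simp: B_def top_pairs_def)
    have "int k - int n = 2 * (int n - int j)"
      using kj by simp
    then show "(case x of (k, j) \<Rightarrow> int k) \<in> {k. r1 n \<le> k \<and> k \<le> r2 n \<and> [k = int n] (mod 2)}"
      using bounds by (simp add: x cong_iff_dvd_diff)
    have "3 * int n - int k = 2 * int j"
      using kj by simp
    then show "(nat (case x of (k, j) \<Rightarrow> int k), nat ((3 * int n - (case x of (k, j) \<Rightarrow> int k)) div 2)) = x"
      by (simp add: x)
  qed auto
  finally show ?thesis
    unfolding F_def .
qed

end
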